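(* Consider the Bayesian posterior density (with respect to $\pi$) $$\pi(\theta|X)=\frac{\prod_{i=1}^np(X_i|\theta)}{\int_\Gamma\prod_{i=1}^np(X_i|\theta)\,d\pi(\theta)} .$$ Consider an arbitrary cover $\{\Gamma_j\}$ of $\Gamma$. Then for all $\rho\in(0,1)$ and $\gamma\ge1$, $$\mathbf{E}_X\mathbf{E}_\pi\pi(\theta|X)D_\rho^{\mathrm{Re}}(q\|p(\cdot|\theta))\le\frac{\gamma\ln\mathbf{E}_\pi e^{-nD_{\mathrm{KL}}(q\|p(\cdot|\theta))}}{\rho(\rho-1)n}+\frac{\gamma-\rho}{\rho(1-\rho)n}\ln\sum_j\pi(\Gamma_j)^{(\gamma-1)/(\gamma-\rho)}(1+r_{\mathrm{ub}}(\Gamma_j))^n .$$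
   Context: $\mathcal{X}$ is a sample space with a measure $\mu$; $q$ is a probability density with respect to $\mu$ (the true density); $X=(X_1,\dots,X_n)$ are $n$ independent samples from $q$; $\mathbf{E}_X$ is expectation over $X$ and $\mathbf{E}_q$ expectation over a single $x\sim q$. $\{p(\cdot|\theta):\theta\in\Gamma\}$ is a family of probability densities with respect to $\mu$ ($q$ need not belong to it); $\pi$ is a probability measure (prior) on $\Gamma$ not depending on $X$; $\mathbf{E}_\pi f(\theta)=\int_\Gamma f\,d\pi$. $D_{\mathrm{KL}}(q\|p)=\mathbf{E}_q\ln(q(x)/p(x))$ and, for $\rho\in(0,1)$, $D_\rho^{\mathrm{Re}}(q\|p)=-\frac{1}{\rho(1-\rho)}\ln\mathbf{E}_q\big(\frac{p(x)}{q(x)}\big)^\rho$. A cover of $\Gamma$ is a countable collection of measurable subsets $\Gamma_j\subset\Gamma$ with $\bigcup_j\Gamma_j=\Gamma$. The upper-bracketing radius of $\Gamma'\subset\Gamma$ is $r_{\mathrm{ub}}(\Gamma')=\int\sup_{\theta\in\Gamma'}p(x|\theta)\,d\mu(x)-1$. All quantities are assumed measurable, and the expressions appearing are assumed to be well defined. *)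

theory Defs
  imports "HOL-Probability.Probability"
begin

text \<open>
  The quantities below may be infinite (for instance a Kullback--Leibler divergence on a set of
  positive prior mass), so they are valued in the extended reals. The library function
  \<open>KL_divergence\<close> is real-valued and returns \<open>0\<close> when the logarithm is not
  integrable, which is why it is not used here.
\<close>

definition ln_ereal :: "ereal \<Rightarrow> ereal" where
  "ln_ereal x =
     (if x \<le> 0 then - \<infinity> else if x = \<infinity> then \<infinity> else ereal (ln (real_of_ereal x)))"

definition exp_ereal :: "ereal \<Rightarrow> ereal" where
  "exp_ereal x =
     (if x = - \<infinity> then 0 else if x = \<infinity> then \<infinity> else ereal (exp (real_of_ereal x)))"

text \<open>
  Integral of an extended-real function as positive part minus negative part
  (\<^term>\<open>e2ennreal\<close> maps negative numbers to \<open>0\<close>). It has its usual meaning as soon as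
  one of the two parts is finite.
\<close>

definition eintegral :: "'a measure \<Rightarrow> ('a \<Rightarrow> ereal) \<Rightarrow> ereal" where
  "eintegral M f =
     enn2ereal (\<integral>\<^sup>+ x. e2ennreal (f x) \<partial>M) - enn2ereal (\<integral>\<^sup>+ x. e2ennreal (- f x) \<partial>M)"

definition prob_density :: "'a measure \<Rightarrow> ('a \<Rightarrow> real) \<Rightarrow> bool" where
  "prob_density \<mu> f \<longleftrightarrow>
     f \<in> borel_measurable \<mu> \<and> (\<forall>x\<in>space \<mu>. 0 \<le> f x) \<and> (\<integral>\<^sup>+ x. ennreal (f x) \<partial>\<mu>) = 1"

definition expect :: "'a measure \<Rightarrow> ('a \<Rightarrow> real) \<Rightarrow> ('a \<Rightarrow> ereal) \<Rightarrow> ereal" where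
  "expect \<mu> q f = eintegral (density \<mu> (\<lambda>x. ennreal (q x))) f"

text \<open>
  Extended-real division gives \<open>q x / p x = \<infinity>\<close> where \<open>p x = 0 < q x\<close>, so the
  divergence is \<open>\<infinity>\<close> when this happens on a set of positive \<open>q\<close>-probability.
\<close>

definition KL :: "'a measure \<Rightarrow> ('a \<Rightarrow> real) \<Rightarrow> ('a \<Rightarrow> real) \<Rightarrow> ereal" where
  "KL \<mu> q p = expect \<mu> q (\<lambda>x. ln_ereal (ereal (q x) / ereal (p x)))"

text \<open>The value is \<open>\<infinity>\<close> when \<open>p\<close> and \<open>q\<close> are mutually singular.\<close>

definition renyi :: "real \<Rightarrow> 'a measure \<Rightarrow> ('a \<Rightarrow> real) \<Rightarrow> ('a \<Rightarrow> real) \<Rightarrow> ereal" where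
  "renyi \<rho> \<mu> q p =
     - ereal (1 / (\<rho> * (1 - \<rho>))) * ln_ereal (expect \<mu> q (\<lambda>x. ereal ((p x / q x) powr \<rho>)))"

definition countable_cover :: "'t measure \<Rightarrow> 'j set \<Rightarrow> ('j \<Rightarrow> 't set) \<Rightarrow> bool" where
  "countable_cover \<pi> J \<Gamma> \<longleftrightarrow>
     countable J \<and> (\<forall>j\<in>J. \<Gamma> j \<in> sets \<pi>) \<and> (\<Union>j\<in>J. \<Gamma> j) = space \<pi>"

text \<open>
  The supremum is taken in \<^typ>\<open>ennreal\<close>, so that it is \<open>0\<close> over an empty cell and
  \<open>\<infinity>\<close> where the densities are unbounded.
\<close>

definition r_ub :: "'a measure \<Rightarrow> ('t \<Rightarrow> 'a \<Rightarrow> real) \<Rightarrow> 't set \<Rightarrow> ereal" where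
  "r_ub \<mu> p A = enn2ereal (\<integral>\<^sup>+ x. (SUP \<theta>\<in>A. ennreal (p \<theta> x)) \<partial>\<mu>) - 1"

definition posterior ::
  "'t measure \<Rightarrow> ('t \<Rightarrow> 'a \<Rightarrow> real) \<Rightarrow> nat \<Rightarrow> (nat \<Rightarrow> 'a) \<Rightarrow> 't \<Rightarrow> ereal" where
  "posterior \<pi> p n x \<theta> =
     ereal (\<Prod>i<n. p \<theta> (x i)) / eintegral \<pi> (\<lambda>\<theta>'. ereal (\<Prod>i<n. p \<theta>' (x i)))"

text \<open>
  Power of a nonnegative real with the usual convention \<open>0\<^sup>0 = 1\<close>;
  \<^const>\<open>powr\<close> has \<open>0 powr 0 = 0\<close>.
\<close>

definition rpow :: "real \<Rightarrow> real \<Rightarrow> real" where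
  "rpow x a = (if a = 0 then 1 else x powr a)"

end

theory Submission
  imports Defs
begin

text \<open>
  Write \<open>Z\<^sub>\<theta> = \<Prod>\<^sub>i p(X\<^sub>i|\<theta>) / q(X\<^sub>i)\<close>, \<open>M = \<integral>Z\<^sub>\<theta> d\<pi>\<close> (the evidence),
  \<open>w\<^sub>\<theta> = Z\<^sub>\<theta> / M\<close> (the posterior density), \<open>A\<^sub>\<theta> = E\<^sub>q (p(x|\<theta>)/q(x)) powr \<rho>\<close> and
  \<open>a = (\<gamma> - 1) / (\<gamma> - \<rho>)\<close>. Up to the factor \<open>\<rho>(1 - \<rho>)n\<close>, the Renyi risk of \<open>\<theta>\<close> is
  \<open>- n ln A\<^sub>\<theta>\<close>, and for every \<open>c > 0\<close> it decomposes as

    \<open>- n ln A\<^sub>\<theta> = ln (Z\<^sub>\<theta> powr \<rho> / (A\<^sub>\<theta>\<^sup>n w\<^sub>\<theta>)) + (\<gamma> - \<rho>) ln (Z\<^sub>\<theta> (w\<^sub>\<theta> powr - a) / c)\<close>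
    \<open>+ (\<gamma> - \<rho>) ln c - \<gamma> ln M\<close>;

  the exponent \<open>a\<close> is exactly the one for which the powers of \<open>Z\<^sub>\<theta>\<close> cancel.

  Bounding the first two logarithms by \<open>ln y \<le> y - 1\<close>, multiplying by \<open>w\<^sub>\<theta>\<close> and integrating
  over the prior and the data leaves three expectations.

  \<^item> \<open>E\<^sub>X \<integral>Z\<^sub>\<theta> powr \<rho> / A\<^sub>\<theta>\<^sup>n d\<pi> \<le> 1\<close>, because \<open>E\<^sub>X (Z\<^sub>\<theta> powr \<rho>) = A\<^sub>\<theta>\<^sup>n\<close> by independence
    (\<open>nn_integral_normalised_powr_le_1\<close>).
  \<^item> \<open>E\<^sub>X \<integral>Z\<^sub>\<theta> (w\<^sub>\<theta> powr (1 - a)) d\<pi>\<close> is at most the sum over the cover in the theorem: on a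
    cell, \<open>Z\<^sub>\<theta>\<close> is at most the product of the suprema, whose expectation is at most the
    \<open>n\<close>-th power of the upper bracketing integral, and the integral of \<open>w powr (1 - a)\<close> over
    a cell of prior mass \<open>m\<close> is at most \<open>m powr a\<close> (\<open>nn_integral_evidence_cover_le\<close>).
    So the second logarithm contributes at most \<open>0\<close> once \<open>c\<close> is chosen as that sum.
  \<^item> \<open>E\<^sub>X ln M \<ge> ln V\<close> with \<open>V\<close> the prior integral of \<open>exp (- n KL)\<close>, by the
    Donsker--Varadhan inequality with the density \<open>exp (- n KL) / V\<close> and
    \<open>E\<^sub>X ln Z\<^sub>\<theta> = - n KL\<close> (\<open>ln_evidence_lower_bound\<close>).

  Working with \<open>ln y \<le> y - 1\<close> rather than with entropies of the posterior avoids every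
  question about the integrability of \<open>w ln w\<close>. Where \<open>V = 0\<close> or the sum over the cover is
  infinite, the right-hand side is \<open>\<infinity>\<close>.
\<close>

section \<open>Extended-real integrals and sums\<close>

lemma eintegral_nonneg:
  assumes "AE x in M. 0 \<le> f x"
  shows "eintegral M f = enn2ereal (\<integral>\<^sup>+x. e2ennreal (f x) \<partial>M)"
proof -
  have "(\<integral>\<^sup>+x. e2ennreal (- f x) \<partial>M) = (\<integral>\<^sup>+x. 0 \<partial>M)"
    using assms by (intro nn_integral_cong_AE) (auto simp: e2ennreal_neg)
  then show ?thesis
    by (simp add: eintegral_def zero_ennreal.rep_eq)
qed

lemma eintegral_le: "eintegral M f \<le> enn2ereal (\<integral>\<^sup>+x. e2ennreal (f x) \<partial>M)"
proof -
  have "a - b \<le> a" if "0 \<le> b" for a b :: ereal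
    using that by (cases a; cases b) auto
  then show ?thesis
    unfolding eintegral_def by simp
qed

lemma measurable_ln_ereal [measurable]: "ln_ereal \<in> borel_measurable borel"
  unfolding ln_ereal_def by measurable

lemma nn_integral_count_space_leI:
  fixes f :: "'j \<Rightarrow> ennreal"
  assumes J: "countable J" and le: "\<And>F. finite F \<Longrightarrow> F \<subseteq> J \<Longrightarrow> sum f F \<le> C"
  shows "(\<integral>\<^sup>+j. f j \<partial>count_space J) \<le> C"
proof (cases "J = {}")
  case True
  then show ?thesis
    by (simp add: nn_integral_empty)
next
  case False
  define F where "F k = from_nat_into J ` {..k}" for k
  have F: "finite (F k)" "F k \<subseteq> J" for k
    using False from_nat_into[of J] by (auto simp: F_def)
  have ex: "\<exists>k. j \<in> F k" if "j \<in> J" for j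
    using from_nat_into_surj[OF J that] by (auto simp: F_def)
  have "(\<integral>\<^sup>+j. f j \<partial>count_space J) = (\<integral>\<^sup>+j. (SUP k. f j * indicator (F k) j) \<partial>count_space J)"
  proof (intro nn_integral_cong)
    fix j assume "j \<in> space (count_space J)"
    then obtain k where "j \<in> F k"
      using ex by auto
    show "f j = (SUP k. f j * indicator (F k) j)"
    proof (rule antisym)
      show "f j \<le> (SUP k. f j * indicator (F k) j)"
        using \<open>j \<in> F k\<close> by (intro SUP_upper2[of k]) auto
      show "(SUP k. f j * indicator (F k) j) \<le> f j"
        by (intro SUP_least) (auto simp: indicator_def)
    qed
  qed
  also have "\<dots> = (SUP k. \<integral>\<^sup>+j. f j * indicator (F k) j \<partial>count_space J)"
  proof (intro nn_integral_monotone_convergence_SUP)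
    show "incseq (\<lambda>k j. f j * indicator (F k) j)"
      by (auto simp: incseq_def le_fun_def F_def indicator_def intro: order_trans)
  qed auto
  also have "\<dots> = (SUP k. sum f (F k))"
  proof (intro SUP_cong refl)
    fix k
    have "(\<integral>\<^sup>+j. f j * indicator (F k) j \<partial>count_space J) = (\<Sum>j\<in>F k. f j * indicator (F k) j)"
      using F by (intro nn_integral_count_space') auto
    then show "(\<integral>\<^sup>+j. f j * indicator (F k) j \<partial>count_space J) = sum f (F k)"
      by simp
  qed
  also have "\<dots> \<le> C"
    using F le by (intro SUP_least) auto
  finally show ?thesis .
qed

lemma
  fixes f :: "'j \<Rightarrow> ennreal"
  shows le_infsum_enn2ereal: "j \<in> J \<Longrightarrow> enn2ereal (f j) \<le> (\<Sum>\<^sub>\<infinity>j\<in>J. enn2ereal (f j))"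
    and nn_integral_count_space_le_infsum: "countable J \<Longrightarrow>
       (\<integral>\<^sup>+j. f j \<partial>count_space J) \<le> e2ennreal (\<Sum>\<^sub>\<infinity>j\<in>J. enn2ereal (f j))"
proof -
  let ?S = "\<Sum>\<^sub>\<infinity>j\<in>J. enn2ereal (f j)"
  have le: "(\<Sum>j\<in>F. enn2ereal (f j)) \<le> ?S" if "finite F" "F \<subseteq> J" for F
    using that by (subst nonneg_infsum_complete) (auto intro!: SUP_upper)
  show "enn2ereal (f j) \<le> ?S" if "j \<in> J"
    using le[of "{j}"] that by simp
  show "(\<integral>\<^sup>+j. f j \<partial>count_space J) \<le> e2ennreal ?S" if "countable J"
  proof (rule nn_integral_count_space_leI[OF that])
    fix F assume F: "finite F" "F \<subseteq> J"
    have "enn2ereal (sum f F) = (\<Sum>j\<in>F. enn2ereal (f j))"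
      using F(1) by (induction F rule: finite_induct) (auto simp: zero_ennreal.rep_eq plus_ennreal.rep_eq)
    then show "sum f F \<le> e2ennreal ?S"
      using e2ennreal_mono[OF le[OF F]] by (metis e2ennreal_enn2ereal)
  qed
qed

lemma
  fixes f :: "'a \<Rightarrow> ennreal"
  assumes f [measurable]: "f \<in> borel_measurable M"
    and le: "(\<integral>\<^sup>+x. f x \<partial>M) \<le> ennreal b" and b: "0 \<le> b"
  shows integrable_enn2real: "integrable M (\<lambda>x. enn2real (f x))"
    and integral_enn2real_le: "(\<integral>x. enn2real (f x) \<partial>M) \<le> b"
    and AE_finite_of_nn_integral_le: "AE x in M. f x < \<infinity>"
proof -
  show fin: "AE x in M. f x < \<infinity>"
    using nn_integral_noteq_infinite[OF f] le_less_trans[OF le ennreal_less_top]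
    by (simp add: less_top)
  then have eq: "(\<integral>\<^sup>+x. ennreal (enn2real (f x)) \<partial>M) = (\<integral>\<^sup>+x. f x \<partial>M)"
    by (intro nn_integral_cong_AE) auto
  then show int: "integrable M (\<lambda>x. enn2real (f x))"
    using le by (intro integrableI_nonneg) (auto intro: le_less_trans)
  have "ennreal (\<integral>x. enn2real (f x) \<partial>M) \<le> ennreal b"
    using int le eq by (subst nn_integral_eq_integral[symmetric]) auto
  then show "(\<integral>x. enn2real (f x) \<partial>M) \<le> b"
    using b by simp
qed

section \<open>Density ratios and divergences\<close>

text \<open>
  Integrating this over a cell of mass \<open>c\<close> against a density \<open>w\<close> gives Hoelder's bound
  \<open>c powr a\<close> on the integral of \<open>w powr (1 - a)\<close>, including the endpoint \<open>a = 0\<close>.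
\<close>

lemma powr_interpolation_le:
  fixes w c a :: real
  assumes "0 \<le> w" "0 < c" "0 \<le> a" "a < 1"
  shows "w powr (1 - a) \<le> c powr a * ((1 - a) * w + a / c)"
proof (cases "w = 0")
  case False
  have "w powr (1 - a) * (1 / c) powr a \<le> (1 - a) * w + a * (1 / c)"
    using False assms by (intro Youngs_inequality_0) auto
  then have "c powr a * (w powr (1 - a) * (1 / c) powr a) \<le> c powr a * ((1 - a) * w + a / c)"
    using assms by (intro mult_left_mono) auto
  moreover have "c powr a * (1 / c) powr a = 1"
    using assms by (simp add: powr_mult[symmetric])
  moreover have "c powr a * (w powr (1 - a) * (1 / c) powr a)
      = w powr (1 - a) * (c powr a * (1 / c) powr a)"
    by (simp only: mult_ac)
  ultimately show ?thesis
    by simp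
qed (use assms in auto)

lemma AE_density_pos:
  assumes "q \<in> borel_measurable \<mu>"
  shows "AE x in density \<mu> (\<lambda>x. ennreal (q x)). 0 < q x"
  using assms by (subst AE_density) auto

text \<open>Only an inequality: the part of \<open>s\<close> that lives on \<open>q = 0\<close> is lost.\<close>

lemma nn_integral_density_ratio_le:
  fixes q :: "'a \<Rightarrow> real" and s :: "'a \<Rightarrow> ennreal"
  assumes [measurable]: "q \<in> borel_measurable \<mu>" "s \<in> borel_measurable \<mu>"
  shows "(\<integral>\<^sup>+x. s x / ennreal (q x) \<partial>density \<mu> (\<lambda>x. ennreal (q x))) \<le> (\<integral>\<^sup>+x. s x \<partial>\<mu>)"
proof -
  have "ennreal (q x) * (s x / ennreal (q x)) \<le> s x" for x
  proof (cases "0 < q x")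
    case True
    then have "ennreal (q x) * (s x / ennreal (q x)) = s x * (ennreal (q x) / ennreal (q x))"
      by (simp add: divide_ennreal_def mult_ac)
    also have "\<dots> = s x"
      using True by (simp add: divide_ennreal)
    finally show ?thesis by simp
  next
    case False
    then show ?thesis by (simp add: ennreal_neg)
  qed
  then show ?thesis
    by (subst nn_integral_density) (auto intro!: nn_integral_mono)
qed

lemma prob_space_density:
  assumes "prob_density \<mu> q"
  shows "prob_space (density \<mu> (\<lambda>x. ennreal (q x)))"
  using assms by (intro prob_spaceI) (auto simp: prob_density_def emeasure_density cong: nn_integral_cong)

lemma nn_integral_likelihood_ratio_le_1:
  assumes q: "prob_density \<mu> q" and p: "prob_density \<mu> p"
  shows "(\<integral>\<^sup>+x. ennreal (p x / q x) \<partial>density \<mu> (\<lambda>x. ennreal (q x))) \<le> 1"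
proof -
  have [measurable]: "q \<in> borel_measurable \<mu>" "p \<in> borel_measurable \<mu>"
    using q p by (auto simp: prob_density_def)
  have "AE x in density \<mu> (\<lambda>x. ennreal (q x)). ennreal (p x / q x) = ennreal (p x) / ennreal (q x)"
    using AE_density_pos[OF \<open>q \<in> borel_measurable \<mu>\<close>] AE_space
    by eventually_elim (use p in \<open>auto simp: prob_density_def divide_ennreal\<close>)
  then have "(\<integral>\<^sup>+x. ennreal (p x / q x) \<partial>density \<mu> (\<lambda>x. ennreal (q x)))
      = (\<integral>\<^sup>+x. ennreal (p x) / ennreal (q x) \<partial>density \<mu> (\<lambda>x. ennreal (q x)))"
    by (rule nn_integral_cong_AE)
  also have "\<dots> \<le> (\<integral>\<^sup>+x. ennreal (p x) \<partial>\<mu>)"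
    by (intro nn_integral_density_ratio_le) auto
  finally show ?thesis
    using p by (simp add: prob_density_def)
qed

text \<open>
  The Hellinger integral \<open>E\<^sub>q (p/q) powr \<rho>\<close>. It is finite, so nothing is lost by making it
  real-valued.
\<close>

definition affinity :: "real \<Rightarrow> 'a measure \<Rightarrow> ('a \<Rightarrow> real) \<Rightarrow> ('a \<Rightarrow> real) \<Rightarrow> real" where
  "affinity \<rho> \<mu> q p =
     enn2real (\<integral>\<^sup>+x. ennreal ((p x / q x) powr \<rho>) \<partial>density \<mu> (\<lambda>x. ennreal (q x)))"

text \<open>
  The bound by \<open>1\<close> is \<open>y powr \<rho> \<le> \<rho> y + (1 - \<rho>)\<close> at the density ratio.
\<close>

lemma
  assumes q: "prob_density \<mu> q" and p: "prob_density \<mu> p" and \<rho>: "0 < \<rho>" "\<rho> < 1"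
  shows nn_integral_powr_ratio:
      "(\<integral>\<^sup>+x. ennreal ((p x / q x) powr \<rho>) \<partial>density \<mu> (\<lambda>x. ennreal (q x)))
         = ennreal (affinity \<rho> \<mu> q p)"
    and affinity_nonneg: "0 \<le> affinity \<rho> \<mu> q p"
    and affinity_le_1: "affinity \<rho> \<mu> q p \<le> 1"
proof -
  let ?Q = "density \<mu> (\<lambda>x. ennreal (q x))"
  interpret Q: prob_space ?Q
    using q by (rule prob_space_density)
  have [measurable]: "q \<in> borel_measurable \<mu>" "p \<in> borel_measurable \<mu>"
    using q p by (auto simp: prob_density_def)
  have "(\<integral>\<^sup>+x. ennreal ((p x / q x) powr \<rho>) \<partial>?Q)
      \<le> (\<integral>\<^sup>+x. ennreal \<rho> * ennreal (p x / q x) + ennreal (1 - \<rho>) \<partial>?Q)"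
  proof (intro nn_integral_mono)
    fix x assume "x \<in> space ?Q"
    then have nonneg: "0 \<le> p x / q x"
      using q p by (auto simp: prob_density_def)
    then have "(p x / q x) powr \<rho> \<le> \<rho> * (p x / q x) + (1 - \<rho>)"
      using powr_interpolation_le[of "p x / q x" 1 "1 - \<rho>"] \<rho> by simp
    then have "ennreal ((p x / q x) powr \<rho>) \<le> ennreal (\<rho> * (p x / q x) + (1 - \<rho>))"
      by (rule ennreal_leI)
    also have "\<dots> = ennreal \<rho> * ennreal (p x / q x) + ennreal (1 - \<rho>)"
      using \<rho> nonneg by (subst ennreal_plus) (auto simp: ennreal_mult simp del: times_divide_eq_right)
    finally show "ennreal ((p x / q x) powr \<rho>) \<le> \<dots>" .
  qed
  also have "\<dots> = ennreal \<rho> * (\<integral>\<^sup>+x. ennreal (p x / q x) \<partial>?Q) + ennreal (1 - \<rho>)"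
    using Q.emeasure_space_1 by (simp add: nn_integral_add nn_integral_cmult del: emeasure_density)
  also have "\<dots> \<le> ennreal \<rho> * 1 + ennreal (1 - \<rho>)"
    by (intro add_mono mult_left_mono nn_integral_likelihood_ratio_le_1 q p) auto
  also have "\<dots> = 1"
    using \<rho> by (simp flip: ennreal_plus)
  finally have le: "(\<integral>\<^sup>+x. ennreal ((p x / q x) powr \<rho>) \<partial>?Q) \<le> 1" .
  then show "(\<integral>\<^sup>+x. ennreal ((p x / q x) powr \<rho>) \<partial>?Q) = ennreal (affinity \<rho> \<mu> q p)"
    unfolding affinity_def by (subst ennreal_enn2real) (auto intro: le_less_trans)
  with le show "affinity \<rho> \<mu> q p \<le> 1"
    by simp
  show "0 \<le> affinity \<rho> \<mu> q p"
    by (simp add: affinity_def)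
qed

lemma renyi_eq:
  assumes "prob_density \<mu> q" "prob_density \<mu> p" "0 < \<rho>" "\<rho> < 1"
  shows "renyi \<rho> \<mu> q p =
    (if affinity \<rho> \<mu> q p = 0 then \<infinity> else ereal (- ln (affinity \<rho> \<mu> q p) / (\<rho> * (1 - \<rho>))))"
proof -
  have "expect \<mu> q (\<lambda>x. ereal ((p x / q x) powr \<rho>)) = ereal (affinity \<rho> \<mu> q p)"
    using nn_integral_powr_ratio[OF assms] affinity_nonneg[OF assms]
    unfolding expect_def by (subst eintegral_nonneg) (auto simp: e2ennreal_ereal)
  moreover have "0 < \<rho> * (1 - \<rho>)"
    using assms by simp
  ultimately show ?thesis
    using affinity_nonneg[OF assms] by (auto simp: renyi_def ln_ereal_def simp del: mult_less_0_iff)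
qed

text \<open>
  With \<open>y = p / q\<close>, whose expectation is at most 1, the negative part of \<open>ln (q / p)\<close> is
  \<open>max 0 (ln y) \<le> y\<close> and so has expectation at most 1: the divergence is never of the form
  \<open>\<infinity> - \<infinity>\<close>, and when it is finite the expectation of \<open>\<bar>ln y\<bar>\<close> exceeds it by at most 2.
  Nonnegativity is \<open>max 0 (ln y) + 1 \<le> max 0 (- ln y) + y\<close>, integrated; this form of
  \<open>ln y \<le> y - 1\<close> has no subtraction and so is available in \<open>ennreal\<close>.
\<close>

lemma
  assumes q: "prob_density \<mu> q" and p: "prob_density \<mu> p"
  shows KL_nonneg: "0 \<le> KL \<mu> q p"
    and AE_pos_of_KL_finite: "KL \<mu> q p < \<infinity> \<Longrightarrow> AE x in density \<mu> (\<lambda>x. ennreal (q x)). 0 < p x"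
    and nn_integral_abs_ln_ratio: "KL \<mu> q p < \<infinity> \<Longrightarrow>
      (\<integral>\<^sup>+x. ennreal \<bar>ln (p x / q x)\<bar> \<partial>density \<mu> (\<lambda>x. ennreal (q x)))
        \<le> ennreal (real_of_ereal (KL \<mu> q p) + 2)"
    and integral_ln_ratio: "KL \<mu> q p < \<infinity> \<Longrightarrow>
      (\<integral>x. ln (p x / q x) \<partial>density \<mu> (\<lambda>x. ennreal (q x))) = - real_of_ereal (KL \<mu> q p)"
proof -
  let ?Q = "density \<mu> (\<lambda>x. ennreal (q x))"
  interpret Q: prob_space ?Q
    using q by (rule prob_space_density)
  have [measurable]: "q \<in> borel_measurable \<mu>" "p \<in> borel_measurable \<mu>"
    using q p by (auto simp: prob_density_def)
  define l where "l x = ln_ereal (ereal (q x) / ereal (p x))" for x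
  define pos where "pos = (\<integral>\<^sup>+x. e2ennreal (l x) \<partial>?Q)"
  define neg where "neg = (\<integral>\<^sup>+x. e2ennreal (- l x) \<partial>?Q)"
  have [measurable]: "l \<in> borel_measurable \<mu>"
    unfolding l_def by measurable
  have KL_eq: "KL \<mu> q p = enn2ereal pos - enn2ereal neg"
    by (simp add: KL_def expect_def eintegral_def l_def pos_def neg_def)
  have AE_q: "AE x in ?Q. 0 < q x \<and> 0 \<le> p x"
    using AE_density_pos[of q \<mu>] AE_space p by (auto simp: prob_density_def)
  have l_eq: "AE x in ?Q. l x = (if p x = 0 then \<infinity> else ereal (- ln (p x / q x)))"
    using AE_q 
    by eventually_elim (auto simp: l_def ln_ereal_def ln_div divide_le_0_iff)
  have "(\<integral>\<^sup>+x. e2ennreal (- l x) \<partial>?Q) \<le> (\<integral>\<^sup>+x. ennreal (p x / q x) \<partial>?Q)"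
  proof (intro nn_integral_mono_AE)
    show "AE x in ?Q. e2ennreal (- l x) \<le> ennreal (p x / q x)"
      using l_eq AE_q
    proof eventually_elim
      case (elim x)
      show ?case
      proof (cases "p x = 0")
        case False
        then have "ln (p x / q x) \<le> p x / q x"
          using elim ln_le_minus_one[of "p x / q x"] by auto
        then show ?thesis
          using elim False by (simp add: e2ennreal_ereal ennreal_leI)
      qed (use elim in \<open>auto simp: e2ennreal_neg\<close>)
    qed
  qed
  then have neg_le: "neg \<le> 1"
    using nn_integral_likelihood_ratio_le_1[OF q p] by (simp add: neg_def)
  have "neg + 1 = (\<integral>\<^sup>+x. e2ennreal (- l x) + 1 \<partial>?Q)"
    using Q.emeasure_space_1 by (simp add: neg_def nn_integral_add del: emeasure_density)
  also have "\<dots> \<le> (\<integral>\<^sup>+x. e2ennreal (l x) + ennreal (p x / q x) \<partial>?Q)"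
  proof (intro nn_integral_mono_AE)
    show "AE x in ?Q. e2ennreal (- l x) + 1 \<le> e2ennreal (l x) + ennreal (p x / q x)"
      using l_eq AE_q
    proof eventually_elim
      case (elim x)
      show ?case
      proof (cases "p x = 0")
        case False
        define y where "y = p x / q x"
        have y: "0 < y" using False elim by (auto simp: y_def)
        have "ln y \<le> y - 1" using y by (rule ln_le_minus_one)
        then have "ennreal (max 0 (ln y) + 1) \<le> ennreal (max 0 (- ln y) + y)"
          by (intro ennreal_leI) auto
        then show ?thesis
          using y elim False
          by (simp add: e2ennreal_ereal ennreal_plus y_def[symmetric] ennreal_max_0 flip: ennreal_1)
      qed (use elim in auto)
    qed
  qed
  also have "\<dots> = pos + (\<integral>\<^sup>+x. ennreal (p x / q x) \<partial>?Q)"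
    by (simp add: pos_def nn_integral_add)
  also have "\<dots> \<le> pos + 1"
    by (intro add_mono nn_integral_likelihood_ratio_le_1 q p order_refl)
  finally have "neg \<le> pos"
    by simp
  then have "enn2ereal neg \<le> enn2ereal pos"
    by (simp add: less_eq_ennreal.rep_eq)
  moreover have neg_fin: "neg < \<infinity>"
    using neg_le by (auto intro: le_less_trans)
  ultimately show "0 \<le> KL \<mu> q p"
    unfolding KL_eq by (cases "enn2ereal pos"; cases "enn2ereal neg") auto
  assume fin: "KL \<mu> q p < \<infinity>"
  have pos_fin: "pos < \<infinity>"
  proof (rule ccontr)
    assume "\<not> pos < \<infinity>"
    then have "pos = \<infinity>" by (simp add: less_top[symmetric])
    then show False
      using fin neg_fin by (cases neg) (auto simp: KL_eq)
  qed
  have KLr: "real_of_ereal (KL \<mu> q p) = enn2real pos - enn2real neg"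
    using pos_fin neg_fin by (cases pos; cases neg) (auto simp: KL_eq)
  have "AE x in ?Q. e2ennreal (l x) \<noteq> \<infinity>"
    using pos_fin by (intro nn_integral_PInf_AE) (auto simp: pos_def)
  then show p_pos: "AE x in ?Q. 0 < p x"
    using l_eq AE_q by eventually_elim (auto simp: less_le)
  have pos_eq: "(\<integral>\<^sup>+x. ennreal (- ln (p x / q x)) \<partial>?Q) = pos"
    and neg_eq: "(\<integral>\<^sup>+x. ennreal (ln (p x / q x)) \<partial>?Q) = neg"
    unfolding pos_def neg_def
    using p_pos l_eq by (auto intro!: nn_integral_cong_AE simp: e2ennreal_ereal)
  have "(\<integral>\<^sup>+x. ennreal \<bar>ln (p x / q x)\<bar> \<partial>?Q)
      = (\<integral>\<^sup>+x. ennreal (- ln (p x / q x)) + ennreal (ln (p x / q x)) \<partial>?Q)"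
    by (intro nn_integral_cong) (auto simp: abs_if ennreal_neg)
  also have "\<dots> = pos + neg"
    by (subst nn_integral_add) (auto simp: pos_eq neg_eq)
  also have "\<dots> = ennreal (real_of_ereal (KL \<mu> q p) + 2 * enn2real neg)"
    using pos_fin neg_fin unfolding KLr by (cases pos; cases neg) (auto simp flip: ennreal_plus)
  also have "\<dots> \<le> ennreal (real_of_ereal (KL \<mu> q p) + 2)"
    using neg_le by (intro ennreal_leI) (cases neg, auto)
  finally show abs_le: "(\<integral>\<^sup>+x. ennreal \<bar>ln (p x / q x)\<bar> \<partial>?Q) \<le> \<dots>" .
  then have "integrable ?Q (\<lambda>x. ln (p x / q x))"
    by (intro integrableI_bounded) (auto intro: le_less_trans)
  then show "(\<integral>x. ln (p x / q x) \<partial>?Q) = - real_of_ereal (KL \<mu> q p)"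
    by (simp add: real_lebesgue_integral_def pos_eq neg_eq KLr)
qed

section \<open>Inequalities for a fixed sample\<close>

text \<open>
  Donsker--Varadhan in the form \<open>\<integral>v ln (z / v) \<le> ln \<integral>z\<close>: from \<open>ln y \<le> y - 1\<close> at \<open>y = z / (v M)\<close> with \<open>M = \<integral>z\<close>.
\<close>

lemma (in prob_space) integral_ln_ratio_le_ln_integral:
  fixes v z g :: "'a \<Rightarrow> real"
  assumes v: "integrable M v" "(\<integral>x. v x \<partial>M) = 1" "AE x in M. 0 \<le> v x"
    and z: "integrable M z" "0 < (\<integral>x. z x \<partial>M)" "AE x in M. 0 \<le> z x"
    and g: "integrable M (\<lambda>x. v x * g x)"
    and eq: "AE x in M. 0 < v x \<longrightarrow> 0 < z x \<and> g x = ln (z x) - ln (v x)"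
  shows "(\<integral>x. v x * g x \<partial>M) \<le> ln (\<integral>x. z x \<partial>M)"
proof -
  define m where "m = (\<integral>x. z x \<partial>M)"
  have m: "0 < m" using z by (simp add: m_def)
  have "(\<integral>x. v x * g x \<partial>M) \<le> (\<integral>x. z x / m - v x + v x * ln m \<partial>M)"
  proof (rule integral_mono_AE)
    show "AE x in M. v x * g x \<le> z x / m - v x + v x * ln m"
      using v(3) z(3) eq
    proof eventually_elim
      case (elim x)
      show ?case
      proof (cases "v x = 0")
        case False
        then have *: "0 < v x" "0 < z x" "g x = ln (z x) - ln (v x)"
          using elim by auto
        have "ln (z x / (v x * m)) \<le> z x / (v x * m) - 1"
          using * m by (intro ln_le_minus_one) auto
        then have "g x - ln m \<le> z x / (v x * m) - 1"
          using * m by (simp add: ln_div ln_mult)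
        then have "v x * (g x - ln m) \<le> v x * (z x / (v x * m) - 1)"
          using * by (intro mult_left_mono) auto
        moreover have "v x * (z x / (v x * m) - 1) = z x / m - v x"
          using * m by (simp add: right_diff_distrib)
        ultimately show ?thesis
          by (simp add: right_diff_distrib)
      qed (use elim m in auto)
    qed
  qed (use v z g in auto)
  also have "\<dots> = m / m - 1 + 1 * ln m"
    using v z by (simp add: m_def)
  finally show ?thesis
    using m by (simp add: m_def)
qed

text \<open>
  The decomposition of \<open>- n ln A\<close> into two logarithms and a remainder, multiplied by the
  posterior density \<open>z / m\<close>. Here \<open>y\<close> and \<open>t\<close> are the arguments of the two logarithms.
\<close>

lemma ln_affinity_pointwise_le:
  fixes z m c A \<rho> \<gamma> a :: real and n :: nat
  assumes pos: "0 < z" "0 < m" "0 < c" "0 < A" and \<rho>: "\<rho> < 1" and \<gamma>: "1 \<le> \<gamma>"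
    and a: "a = (\<gamma> - 1) / (\<gamma> - \<rho>)"
  shows "z / m * (- (real n * ln A)) \<le>
    z powr \<rho> / A ^ n - z / m
      + (\<gamma> - \<rho>) * (z * (z / m) powr (1 - a) / c - z / m + z / m * ln c) - \<gamma> * (z / m) * ln m"
proof -
  define w where "w = z / m"
  have w: "0 < w" using pos by (simp add: w_def)
  have g: "0 < \<gamma> - \<rho>" using \<rho> \<gamma> by simp
  have ag: "(\<gamma> - \<rho>) * a = \<gamma> - 1" using g by (simp add: a)
  have lw: "ln w = ln z - ln m" using pos by (simp add: w_def ln_div)
  define y where "y = z powr \<rho> / A ^ n / w"
  define t where "t = z * w powr (- a) / c"
  have yt: "0 < y" "0 < t" using pos w by (auto simp: y_def t_def)
  have ly: "ln y = \<rho> * ln z - real n * ln A - ln w"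
    using pos w by (simp add: y_def ln_div ln_mult ln_powr ln_realpow)
  have lt: "ln t = ln z - a * ln w - ln c"
    using pos w by (simp add: t_def ln_div ln_mult ln_powr)
  have "ln y + (\<gamma> - \<rho>) * ln t
      = - (real n * ln A) + \<rho> * ln z - ln w + (\<gamma> - \<rho>) * ln z - ((\<gamma> - \<rho>) * a) * ln w - (\<gamma> - \<rho>) * ln c"
    by (simp add: ly lt algebra_simps)
  also have "\<dots> = - (real n * ln A) + \<gamma> * ln m - (\<gamma> - \<rho>) * ln c"
    unfolding ag lw by (simp add: algebra_simps)
  finally have eq: "- (real n * ln A) = ln y + (\<gamma> - \<rho>) * ln t + (\<gamma> - \<rho>) * ln c - \<gamma> * ln m"
    by simp
  have "ln y \<le> y - 1" "(\<gamma> - \<rho>) * ln t \<le> (\<gamma> - \<rho>) * (t - 1)"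
    using yt g by (auto intro!: ln_le_minus_one mult_left_mono)
  then have "- (real n * ln A) \<le> y - 1 + (\<gamma> - \<rho>) * (t - 1) + (\<gamma> - \<rho>) * ln c - \<gamma> * ln m"
    unfolding eq by linarith
  then have "w * (- (real n * ln A)) \<le> w * (y - 1 + (\<gamma> - \<rho>) * (t - 1) + (\<gamma> - \<rho>) * ln c - \<gamma> * ln m)"
    using w by (intro mult_left_mono) auto
  also have "\<dots> = w * y - w + (\<gamma> - \<rho>) * (w * t - w + w * ln c) - \<gamma> * w * ln m"
    by (simp add: algebra_simps)
  also have "w * y = z powr \<rho> / A ^ n"
    using w by (simp add: y_def)
  also have "w * t = z * w powr (1 - a) / c"
    using w by (simp add: t_def powr_diff powr_minus divide_simps)
  finally show ?thesis
    unfolding w_def .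
qed

text \<open>
  The integrated form. Finiteness of \<open>U\<close> forces \<open>z = 0\<close> almost everywhere on \<open>A = 0\<close>, so
  an infinite divergence carries no posterior mass. Nonnegativity of the bound \<open>R\<close> makes
  \<open>ennreal R\<close> lossless.
\<close>

lemma (in prob_space) posterior_risk_le:
  fixes z A :: "'a \<Rightarrow> real" and n :: nat and \<rho> \<gamma> a c m :: real
  assumes z: "integrable M z" "\<And>x. x \<in> space M \<Longrightarrow> 0 \<le> z x"
    and A [measurable]: "A \<in> borel_measurable M" and A0: "\<And>x. x \<in> space M \<Longrightarrow> 0 \<le> A x"
    and A1: "\<And>x. x \<in> space M \<Longrightarrow> A x \<le> 1"
    and m: "m = (\<integral>x. z x \<partial>M)" "0 < m"
    and n: "1 \<le> n" and c: "0 < c"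
    and \<rho>: "0 < \<rho>" "\<rho> < 1" and \<gamma>: "1 \<le> \<gamma>" and a: "a = (\<gamma> - 1) / (\<gamma> - \<rho>)"
    and U: "U = (\<integral>\<^sup>+x. ennreal (z x powr \<rho>) / ennreal (A x ^ n) \<partial>M)" "U < \<infinity>"
    and T: "T = (\<integral>\<^sup>+x. ennreal (z x * (z x / m) powr (1 - a)) \<partial>M)" "T < \<infinity>"
  defines "R \<equiv> (enn2real U - 1 + (\<gamma> - \<rho>) * (enn2real T / c - 1 + ln c) - \<gamma> * ln m) / (\<rho> * (1 - \<rho>) * real n)"
  shows "0 \<le> R"
    and "(\<integral>\<^sup>+x. e2ennreal (ereal (z x / m) *
            (if A x = 0 then \<infinity> else ereal (- ln (A x) / (\<rho> * (1 - \<rho>))))) \<partial>M) \<le> ennreal R"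
proof -
  define w where "w x = z x / m" for x
  define u where "u = (\<lambda>x. z x powr \<rho> / A x ^ n)"
  define t where "t = (\<lambda>x. z x * w x powr (1 - a))"
  define \<kappa> where "\<kappa> = \<rho> * (1 - \<rho>) * real n"
  have \<kappa>: "0 < \<kappa>" using \<rho> n by (simp add: \<kappa>_def)
  have [measurable]: "z \<in> borel_measurable M" using z by auto
  have w: "integrable M w" "(\<integral>x. w x \<partial>M) = 1"
    using z m by (auto simp: w_def[abs_def])
  \<comment> \<open>A positive number divided by \<open>0\<close> is \<open>\<infinity>\<close> in \<open>ennreal\<close>, whereas \<open>0 / 0 = 0\<close>.\<close>
  have "AE x in M. ennreal (z x powr \<rho>) / ennreal (A x ^ n) \<noteq> \<infinity>"
    using U by (intro nn_integral_PInf_AE) auto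
  then have A_pos: "AE x in M. z x = 0 \<or> 0 < A x"
    using AE_space
  proof eventually_elim
    case (elim x)
    show ?case
    proof (rule ccontr)
      assume "\<not> ?thesis"
      then have "0 < z x" "A x = 0"
        using z(2)[of x] A0[of x] elim by auto
      then show False
        using elim n by (simp add: power_0_left ennreal_divide_zero)
    qed
  qed
  have u_eq: "AE x in M. ennreal (z x powr \<rho>) / ennreal (A x ^ n) = ennreal (u x)"
    using A_pos
    by eventually_elim (auto simp: u_def divide_ennreal)
  have U_eq: "U = (\<integral>\<^sup>+x. ennreal (u x) \<partial>M)"
    using u_eq unfolding U by (rule nn_integral_cong_AE)
  have u0: "AE x in M. 0 \<le> u x"
    using AE_space by eventually_elim (auto simp: u_def A0)
  have u: "integrable M u" "(\<integral>x. u x \<partial>M) = enn2real U"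
    using U(2) u0 unfolding U_eq
    by (auto intro!: integrableI_nonneg integral_eq_nn_integral simp: u_def)
  have t0: "AE x in M. 0 \<le> t x"
    using AE_space by eventually_elim (auto simp: t_def z)
  have T_eq: "T = (\<integral>\<^sup>+x. ennreal (t x) \<partial>M)"
    by (simp add: T t_def w_def)
  have t: "integrable M t" "(\<integral>x. t x \<partial>M) = enn2real T"
    using T(2) t0 unfolding T_eq
    by (auto intro!: integrableI_nonneg integral_eq_nn_integral simp: t_def w_def)
  define g where "g x = u x - w x + (\<gamma> - \<rho>) * (t x / c - w x + w x * ln c) - \<gamma> * w x * ln m" for x
  have g: "integrable M (\<lambda>x. g x / \<kappa>)" "(\<integral>x. g x / \<kappa> \<partial>M) = R"
    using u t w by (auto simp: g_def R_def \<kappa>_def)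
  have le: "AE x in M. 0 \<le> g x / \<kappa> \<and> e2ennreal (ereal (z x / m) *
      (if A x = 0 then \<infinity> else ereal (- ln (A x) / (\<rho> * (1 - \<rho>))))) \<le> ennreal (g x / \<kappa>)"
    using A_pos AE_space
  proof eventually_elim
    case (elim x)
    show ?case
    proof (cases "z x = 0")
      case True
      then have "g x = 0" by (simp add: g_def u_def t_def w_def)
      then show ?thesis using True by auto
    next
      case False
      then have pos: "0 < z x" "0 < A x" using elim z(2)[of x] by auto
      have "w x * (- (real n * ln (A x))) \<le> g x"
        unfolding g_def u_def t_def w_def
        by (intro ln_affinity_pointwise_le pos m c \<rho> \<gamma> a)
      then have "w x * (- (real n * ln (A x))) / \<kappa> \<le> g x / \<kappa>"
        using \<kappa> by (intro divide_right_mono) auto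
      also have "w x * (- (real n * ln (A x))) / \<kappa> = w x * (- ln (A x) / (\<rho> * (1 - \<rho>)))"
        using n by (simp add: \<kappa>_def)
      finally have *: "w x * (- ln (A x) / (\<rho> * (1 - \<rho>))) \<le> g x / \<kappa>" .
      have "0 \<le> w x * (- ln (A x) / (\<rho> * (1 - \<rho>)))"
        using pos m \<rho> A1[of x] elim by (intro mult_nonneg_nonneg divide_nonneg_nonneg) (auto simp: w_def)
      with * show ?thesis
        using pos by (auto simp: w_def e2ennreal_ereal intro!: ennreal_leI)
    qed
  qed
  show "0 \<le> R"
    unfolding g(2)[symmetric] using le by (intro integral_nonneg_AE) auto
  have "(\<integral>\<^sup>+x. e2ennreal (ereal (z x / m) *
            (if A x = 0 then \<infinity> else ereal (- ln (A x) / (\<rho> * (1 - \<rho>))))) \<partial>M)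
      \<le> (\<integral>\<^sup>+x. ennreal (g x / \<kappa>) \<partial>M)"
    using le by (intro nn_integral_mono_AE) auto
  also have "\<dots> = ennreal R"
    unfolding g(2)[symmetric] using g(1) le by (intro nn_integral_eq_integral) auto
  finally show "(\<integral>\<^sup>+x. e2ennreal (ereal (z x / m) *
            (if A x = 0 then \<infinity> else ereal (- ln (A x) / (\<rho> * (1 - \<rho>))))) \<partial>M) \<le> ennreal R" .
qed

text \<open>
  One cell of the cover: \<open>z\<close> is replaced by its bound \<open>s\<close>, and the remaining power of the
  density \<open>z / m\<close> is interpolated at the mass of the cell. A null cell contributes \<open>0\<close> whatever
  \<open>s\<close> and the convention for \<open>0\<close> to the power \<open>0\<close> are.
\<close>

lemma (in prob_space) nn_integral_cell_le:
  fixes z :: "'a \<Rightarrow> real" and a :: real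
  assumes z: "integrable M z" "\<And>x. x \<in> space M \<Longrightarrow> 0 \<le> z x"
    and m: "m = (\<integral>x. z x \<partial>M)" "0 < m"
    and a: "0 \<le> a" "a < 1" and G [measurable]: "G \<in> events"
    and s: "\<And>x. x \<in> G \<Longrightarrow> ennreal (z x) \<le> s"
  shows "(\<integral>\<^sup>+x. ennreal (z x * (z x / m) powr (1 - a)) * indicator G x \<partial>M) \<le> ennreal (rpow (prob G) a) * s"
proof (cases "prob G = 0")
  case True
  then have "AE x in M. x \<notin> G"
    using G by (simp add: prob_eq_0)
  then have "(\<integral>\<^sup>+x. ennreal (z x * (z x / m) powr (1 - a)) * indicator G x \<partial>M) = (\<integral>\<^sup>+x. 0 \<partial>M)"
    by (intro nn_integral_cong_AE) (auto simp: indicator_def)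
  then show ?thesis by simp
next
  case False
  define c where "c = prob G"
  have c: "0 < c" using False by (simp add: c_def less_le)
  have rpow: "rpow (prob G) a = c powr a"
    using c by (simp add: rpow_def c_def)
  have [measurable]: "z \<in> borel_measurable M"
    using z by auto
  have mass: "(\<integral>\<^sup>+x. ennreal (z x / m) \<partial>M) = 1"
    using z m by (subst nn_integral_eq_integral) auto
  have "(\<integral>\<^sup>+x. ennreal (z x * (z x / m) powr (1 - a)) * indicator G x \<partial>M)
      \<le> (\<integral>\<^sup>+x. ennreal (c powr a) * s *
          (ennreal (1 - a) * ennreal (z x / m) + ennreal (a / c) * indicator G x) \<partial>M)"
  proof (intro nn_integral_mono)
    fix x assume x: "x \<in> space M"
    show "ennreal (z x * (z x / m) powr (1 - a)) * indicator G x
      \<le> ennreal (c powr a) * s * (ennreal (1 - a) * ennreal (z x / m) + ennreal (a / c) * indicator G x)"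
    proof (cases "x \<in> G")
      case True
      have w: "0 \<le> z x / m" using z(2)[OF x] m by simp
      have "ennreal (z x * (z x / m) powr (1 - a)) = ennreal (z x) * ennreal ((z x / m) powr (1 - a))"
        using z(2)[OF x] by (simp add: ennreal_mult)
      also have "\<dots> \<le> s * ennreal (c powr a * ((1 - a) * (z x / m) + a / c))"
        using s[OF True] powr_interpolation_le[OF w c a] by (intro mult_mono ennreal_leI) auto
      also have "ennreal (c powr a * ((1 - a) * (z x / m) + a / c))
          = ennreal (c powr a) * (ennreal (1 - a) * ennreal (z x / m) + ennreal (a / c))"
        using a c w by (simp add: ennreal_mult ennreal_plus del: times_divide_eq_right)
      finally show ?thesis
        using True by (simp add: mult_ac)
    qed simp
  qed
  also have "\<dots> = ennreal (c powr a) * s * (ennreal (1 - a) + ennreal (a / c) * emeasure M G)"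
    by (simp add: nn_integral_cmult nn_integral_add mass)
  also have "ennreal (1 - a) + ennreal (a / c) * emeasure M G = 1"
    using a c by (simp add: emeasure_eq_measure c_def[symmetric] flip: ennreal_mult ennreal_plus)
  finally show ?thesis
    by (simp add: rpow)
qed

section \<open>Likelihood ratios of an independent sample\<close>

text \<open>
  Integrals over parameters and data are exchanged on \<open>\<pi> \<Otimes> P\<close>, and the divergences are shown to
  be measurable in \<open>\<theta>\<close> on \<open>\<pi> \<Otimes> Q\<close>: both are products of probability measures, whereas \<open>\<mu>\<close> may
  fail to be \<open>\<sigma>\<close>-finite.
\<close>

locale iid_bayes = data: prob_space P + \<pi>: prob_space \<pi>
  for P :: "'w measure" and \<pi> :: "'t measure" +
  fixes \<mu> :: "'a measure" and q :: "'a \<Rightarrow> real" and p :: "'t \<Rightarrow> 'a \<Rightarrow> real"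
    and X :: "nat \<Rightarrow> 'w \<Rightarrow> 'a" and n :: nat
  assumes q: "prob_density \<mu> q"
    and n: "1 \<le> n"
    and X_indep: "data.indep_vars (\<lambda>_. \<mu>) X {..<n}"
    and X_density: "\<And>i. i < n \<Longrightarrow> distributed P \<mu> (X i) (\<lambda>x. ennreal (q x))"
    and p: "\<And>\<theta>. \<theta> \<in> space \<pi> \<Longrightarrow> prob_density \<mu> (p \<theta>)"
    and p_measurable: "(\<lambda>(\<theta>, x). p \<theta> x) \<in> borel_measurable (\<pi> \<Otimes>\<^sub>M \<mu>)"
begin

abbreviation Q :: "'a measure" where
  "Q \<equiv> density \<mu> (\<lambda>x. ennreal (q x))"

text \<open>
  The likelihood ratio \<open>Z\<^sub>\<theta>\<close>. Almost surely every \<open>q(X\<^sub>i)\<close> is positive, so the value \<open>0\<close> of a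
  quotient with denominator \<open>0\<close> is harmless.
\<close>

definition lratio :: "'t \<Rightarrow> 'w \<Rightarrow> real" where
  "lratio \<theta> \<omega> = (\<Prod>i<n. p \<theta> (X i \<omega>) / q (X i \<omega>))"

definition evidence :: "'w \<Rightarrow> real" where
  "evidence \<omega> = (\<integral>\<theta>. lratio \<theta> \<omega> \<partial>\<pi>)"

sublocale Q: prob_space Q
  using q by (rule prob_space_density)

sublocale pair_sigma_finite \<pi> P ..

lemma q_measurable [measurable]: "q \<in> borel_measurable \<mu>"
  using q by (auto simp: prob_density_def)

lemma p_section_measurable [measurable]: "\<theta> \<in> space \<pi> \<Longrightarrow> p \<theta> \<in> borel_measurable \<mu>"
  using p by (auto simp: prob_density_def)

lemma X_measurable: "i < n \<Longrightarrow> X i \<in> P \<rightarrow>\<^sub>M \<mu>"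
  using X_density by (auto simp: distributed_def)

lemma distr_X: "i < n \<Longrightarrow> distr P \<mu> (X i) = Q"
  using X_density by (auto simp: distributed_def)

lemma p_X_measurable: "i < n \<Longrightarrow> (\<lambda>(\<theta>, \<omega>). p \<theta> (X i \<omega>)) \<in> borel_measurable (\<pi> \<Otimes>\<^sub>M P)"
proof -
  assume "i < n"
  then have [measurable]: "X i \<in> P \<rightarrow>\<^sub>M \<mu>" by (rule X_measurable)
  have "(\<lambda>x. (\<lambda>(\<theta>, x). p \<theta> x) (fst x, X i (snd x))) \<in> borel_measurable (\<pi> \<Otimes>\<^sub>M P)"
    by (rule measurable_compose[OF _ p_measurable]) measurable
  then show ?thesis by (simp add: split_beta')
qed

lemma q_X_measurable: "i < n \<Longrightarrow> (\<lambda>\<omega>. q (X i \<omega>)) \<in> borel_measurable P"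
  by (rule measurable_compose[OF X_measurable q_measurable])

lemma q_X_measurable_pair: "i < n \<Longrightarrow> (\<lambda>(\<theta>, \<omega>). q (X i \<omega>)) \<in> borel_measurable (\<pi> \<Otimes>\<^sub>M P)"
  using measurable_compose[OF measurable_snd q_X_measurable] by (simp add: split_beta')

lemma lratio_measurable [measurable]: "(\<lambda>(\<theta>, \<omega>). lratio \<theta> \<omega>) \<in> borel_measurable (\<pi> \<Otimes>\<^sub>M P)"
  using p_X_measurable q_X_measurable_pair unfolding lratio_def split_beta'
  by (intro borel_measurable_prod borel_measurable_divide) auto

lemma nn_integral_X:
  assumes "i < n" "h \<in> borel_measurable \<mu>"
  shows "(\<integral>\<^sup>+\<omega>. h (X i \<omega>) \<partial>P) = (\<integral>\<^sup>+x. h x \<partial>Q)"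
  using assms X_measurable[of i] by (subst distr_X[symmetric]) (auto simp: nn_integral_distr)

lemma AE_X:
  assumes "AE x in Q. \<phi> x" "i < n"
  shows "AE \<omega> in P. \<phi> (X i \<omega>)"
  using AE_distrD[OF X_measurable, of i \<phi>] assms by (simp only: distr_X)

lemma AE_q_pos: "AE \<omega> in P. \<forall>i\<in>{..<n}. 0 < q (X i \<omega>)"
  by (intro AE_finite_allI AE_X[OF AE_density_pos]) auto

lemma nn_integral_prod_X:
  assumes "h \<in> borel_measurable \<mu>"
  shows "(\<integral>\<^sup>+\<omega>. (\<Prod>i<n. h (X i \<omega>)) \<partial>P) = (\<integral>\<^sup>+x. h x \<partial>Q) ^ n"
proof -
  have "(\<integral>\<^sup>+\<omega>. (\<Prod>i<n. h (X i \<omega>)) \<partial>P) = (\<Prod>i<n. \<integral>\<^sup>+\<omega>. h (X i \<omega>) \<partial>P)"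
    using assms by (intro data.indep_vars_nn_integral data.indep_vars_compose2[OF X_indep]) auto
  also have "\<dots> = (\<integral>\<^sup>+x. h x \<partial>Q) ^ n"
    using assms by (simp add: nn_integral_X)
  finally show ?thesis .
qed

lemma ratio_X_nonneg:
  assumes "\<theta> \<in> space \<pi>" "\<omega> \<in> space P" "i < n"
  shows "0 \<le> p \<theta> (X i \<omega>) / q (X i \<omega>)"
proof -
  have "X i \<omega> \<in> space \<mu>" using X_measurable[OF assms(3)] assms(2) by (rule measurable_space)
  then show ?thesis
    using p[OF assms(1)] q by (auto simp: prob_density_def)
qed

lemma lratio_nonneg: "\<theta> \<in> space \<pi> \<Longrightarrow> \<omega> \<in> space P \<Longrightarrow> 0 \<le> lratio \<theta> \<omega>"
  unfolding lratio_def by (intro prod_nonneg) (auto simp: ratio_X_nonneg)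

lemma nn_integral_lratio_le_1:
  assumes "\<theta> \<in> space \<pi>"
  shows "(\<integral>\<^sup>+\<omega>. ennreal (lratio \<theta> \<omega>) \<partial>P) \<le> 1"
proof -
  have [measurable]: "p \<theta> \<in> borel_measurable \<mu>" using assms by measurable
  have "(\<integral>\<^sup>+\<omega>. ennreal (lratio \<theta> \<omega>) \<partial>P) = (\<integral>\<^sup>+\<omega>. (\<Prod>i<n. ennreal (p \<theta> (X i \<omega>) / q (X i \<omega>))) \<partial>P)"
    unfolding lratio_def using assms
    by (intro nn_integral_cong prod_ennreal[symmetric] ratio_X_nonneg) auto
  also have "\<dots> = (\<integral>\<^sup>+x. ennreal (p \<theta> x / q x) \<partial>Q) ^ n"
    by (rule nn_integral_prod_X) measurable
  also have "\<dots> \<le> 1"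
    by (intro power_le_one nn_integral_likelihood_ratio_le_1 q p assms) simp
  finally show ?thesis .
qed

lemma nn_integral_lratio_powr:
  assumes "\<theta> \<in> space \<pi>" and \<rho>: "0 < \<rho>" "\<rho> < 1"
  shows "(\<integral>\<^sup>+\<omega>. ennreal (lratio \<theta> \<omega> powr \<rho>) \<partial>P) = ennreal (affinity \<rho> \<mu> q (p \<theta>) ^ n)"
proof -
  have [measurable]: "p \<theta> \<in> borel_measurable \<mu>" using assms by measurable
  have "(\<integral>\<^sup>+\<omega>. ennreal (lratio \<theta> \<omega> powr \<rho>) \<partial>P)
      = (\<integral>\<^sup>+\<omega>. (\<Prod>i<n. ennreal ((p \<theta> (X i \<omega>) / q (X i \<omega>)) powr \<rho>)) \<partial>P)"
    by (intro nn_integral_cong) (auto simp: lratio_def prod_ennreal prod_powr_distrib ratio_X_nonneg assms)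
  also have "\<dots> = (\<integral>\<^sup>+x. ennreal ((p \<theta> x / q x) powr \<rho>) \<partial>Q) ^ n"
    by (rule nn_integral_prod_X) measurable
  finally show ?thesis
    using nn_integral_powr_ratio[OF q p[OF assms(1)] \<rho>] affinity_nonneg[OF q p[OF assms(1)] \<rho>]
    by (simp add: ennreal_power)
qed

lemma p_measurable_Q: "(\<lambda>(\<theta>, x). p \<theta> x) \<in> borel_measurable (\<pi> \<Otimes>\<^sub>M Q)"
  using p_measurable by (subst measurable_cong_sets[OF sets_pair_measure_cong]) auto

lemma affinity_measurable [measurable]: "(\<lambda>\<theta>. affinity \<rho> \<mu> q (p \<theta>)) \<in> borel_measurable \<pi>"
proof -
  note p_measurable_Q[unfolded split_beta', measurable]
  show ?thesis
    unfolding affinity_def by measurable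
qed

lemma KL_measurable [measurable]: "(\<lambda>\<theta>. KL \<mu> q (p \<theta>)) \<in> borel_measurable \<pi>"
proof -
  note p_measurable_Q[unfolded split_beta', measurable]
  have [measurable]: "(\<lambda>x. ln_ereal (ereal (q (snd x)) / ereal (p (fst x) (snd x))))
      \<in> borel_measurable (\<pi> \<Otimes>\<^sub>M Q)"
    by measurable
  show ?thesis
    unfolding KL_def expect_def eintegral_def by measurable
qed

text \<open>
  After Fubini the inner integral is \<open>A\<^sup>n / A\<^sup>n\<close> for the affinity \<open>A\<close> at \<open>\<theta>\<close>. Where \<open>A = 0\<close> this is
  \<open>0 / 0 = 0\<close>, so only \<open>\<le>\<close> holds.
\<close>

lemma nn_integral_normalised_powr_le_1:
  assumes \<rho>: "0 < \<rho>" "\<rho> < 1"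
  shows "(\<integral>\<^sup>+\<omega>. \<integral>\<^sup>+\<theta>. ennreal (lratio \<theta> \<omega> powr \<rho>) / ennreal (affinity \<rho> \<mu> q (p \<theta>) ^ n) \<partial>\<pi> \<partial>P) \<le> 1"
proof -
  note lratio_measurable[unfolded split_beta', measurable]
  have "(\<integral>\<^sup>+\<omega>. \<integral>\<^sup>+\<theta>. ennreal (lratio \<theta> \<omega> powr \<rho>) / ennreal (affinity \<rho> \<mu> q (p \<theta>) ^ n) \<partial>\<pi> \<partial>P)
      = (\<integral>\<^sup>+\<theta>. \<integral>\<^sup>+\<omega>. ennreal (lratio \<theta> \<omega> powr \<rho>) / ennreal (affinity \<rho> \<mu> q (p \<theta>) ^ n) \<partial>P \<partial>\<pi>)"
    by (rule Fubini') measurable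
  also have "\<dots> \<le> (\<integral>\<^sup>+\<theta>. 1 \<partial>\<pi>)"
  proof (intro nn_integral_mono)
    fix \<theta> assume \<theta>: "\<theta> \<in> space \<pi>"
    let ?A = "affinity \<rho> \<mu> q (p \<theta>)"
    have [measurable]: "lratio \<theta> \<in> borel_measurable P"
      using \<theta> by measurable
    have "(\<integral>\<^sup>+\<omega>. ennreal (lratio \<theta> \<omega> powr \<rho>) / ennreal (?A ^ n) \<partial>P) = ennreal (?A ^ n) / ennreal (?A ^ n)"
      using nn_integral_lratio_powr[OF \<theta> \<rho>] by (subst nn_integral_divide) auto
    also have "\<dots> \<le> 1"
      using affinity_nonneg[OF q p[OF \<theta>] \<rho>] n by (cases "?A = 0") (auto simp: divide_ennreal power_0_left)
    finally show "(\<integral>\<^sup>+\<omega>. ennreal (lratio \<theta> \<omega> powr \<rho>) / ennreal (?A ^ n) \<partial>P) \<le> 1" .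
  qed
  finally show ?thesis by (simp add: \<pi>.emeasure_space_1)
qed

lemma AE_integrable_lratio: "AE \<omega> in P. integrable \<pi> (\<lambda>\<theta>. lratio \<theta> \<omega>)"
proof -
  note lratio_measurable[unfolded split_beta', measurable]
  have "(\<integral>\<^sup>+\<omega>. \<integral>\<^sup>+\<theta>. ennreal (lratio \<theta> \<omega>) \<partial>\<pi> \<partial>P) = (\<integral>\<^sup>+\<theta>. \<integral>\<^sup>+\<omega>. ennreal (lratio \<theta> \<omega>) \<partial>P \<partial>\<pi>)"
    by (rule Fubini') measurable
  also have "\<dots> \<le> (\<integral>\<^sup>+\<theta>. 1 \<partial>\<pi>)"
    by (intro nn_integral_mono nn_integral_lratio_le_1)
  finally have "(\<integral>\<^sup>+\<omega>. \<integral>\<^sup>+\<theta>. ennreal (lratio \<theta> \<omega>) \<partial>\<pi> \<partial>P) \<noteq> \<infinity>"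
    by (auto simp: \<pi>.emeasure_space_1 top_unique)
  then have "AE \<omega> in P. (\<integral>\<^sup>+\<theta>. ennreal (lratio \<theta> \<omega>) \<partial>\<pi>) \<noteq> \<infinity>"
    by (intro nn_integral_PInf_AE) measurable
  then show ?thesis
    using AE_space
  proof eventually_elim
    case (elim \<omega>)
    have "(\<integral>\<^sup>+\<theta>. ennreal (norm (lratio \<theta> \<omega>)) \<partial>\<pi>) = (\<integral>\<^sup>+\<theta>. ennreal (lratio \<theta> \<omega>) \<partial>\<pi>)"
      using elim by (intro nn_integral_cong) (auto simp: lratio_nonneg)
    then show ?case
      using elim by (intro integrableI_bounded) (auto simp: less_top)
  qed
qed

lemma evidence_measurable [measurable]: "evidence \<in> borel_measurable P"
proof -
  have "(\<lambda>(\<omega>, \<theta>). lratio \<theta> \<omega>) \<in> borel_measurable (P \<Otimes>\<^sub>M \<pi>)"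
    using measurable_pair_swap[OF lratio_measurable] by simp
  then show ?thesis
    unfolding evidence_def[abs_def] by (intro \<pi>.borel_measurable_lebesgue_integral) auto
qed

section \<open>Lower bound on the evidence\<close>

text \<open>
  The Gibbs weight \<open>exp (- n KL)\<close>. Divided by its integral it is the density, relative to the
  prior, at which Donsker--Varadhan is applied to bound the evidence.
\<close>

definition boltzmann :: "'t \<Rightarrow> real" where
  "boltzmann \<theta> =
     (if KL \<mu> q (p \<theta>) = \<infinity> then 0 else exp (- (real n * real_of_ereal (KL \<mu> q (p \<theta>)))))"

lemma boltzmann_measurable [measurable]: "boltzmann \<in> borel_measurable \<pi>"
  unfolding boltzmann_def by measurable

lemma boltzmann_bounds: "\<theta> \<in> space \<pi> \<Longrightarrow> 0 \<le> boltzmann \<theta>" "\<theta> \<in> space \<pi> \<Longrightarrow> boltzmann \<theta> \<le> 1"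
  using KL_nonneg[OF q p[of \<theta>]] by (auto simp: boltzmann_def intro!: mult_nonneg_nonneg real_of_ereal_pos)

lemma integrable_boltzmann: "integrable \<pi> boltzmann"
  by (rule \<pi>.integrable_const_bound[where B = 1]) (auto simp: boltzmann_bounds)

lemma eintegral_exp_KL:
  "eintegral \<pi> (\<lambda>\<theta>. exp_ereal (- (ereal (real n) * KL \<mu> q (p \<theta>)))) = ereal (\<integral>\<theta>. boltzmann \<theta> \<partial>\<pi>)"
proof -
  have eq: "exp_ereal (- (ereal (real n) * KL \<mu> q (p \<theta>))) = ereal (boltzmann \<theta>)"
    if "\<theta> \<in> space \<pi>" for \<theta>
    using KL_nonneg[OF q p[OF that]] n
    by (cases "KL \<mu> q (p \<theta>)") (auto simp: boltzmann_def exp_ereal_def)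
  have "eintegral \<pi> (\<lambda>\<theta>. exp_ereal (- (ereal (real n) * KL \<mu> q (p \<theta>))))
      = enn2ereal (\<integral>\<^sup>+\<theta>. e2ennreal (exp_ereal (- (ereal (real n) * KL \<mu> q (p \<theta>)))) \<partial>\<pi>)"
    by (intro eintegral_nonneg AE_I2) (simp add: eq boltzmann_bounds)
  also have "(\<integral>\<^sup>+\<theta>. e2ennreal (exp_ereal (- (ereal (real n) * KL \<mu> q (p \<theta>)))) \<partial>\<pi>)
      = (\<integral>\<^sup>+\<theta>. ennreal (boltzmann \<theta>) \<partial>\<pi>)"
    by (intro nn_integral_cong) (simp add: eq e2ennreal_ereal)
  also have "\<dots> = ennreal (\<integral>\<theta>. boltzmann \<theta> \<partial>\<pi>)"
    by (intro nn_integral_eq_integral integrable_boltzmann AE_I2 boltzmann_bounds)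
  finally show ?thesis
    by (simp add: enn2ereal_ennreal integral_nonneg_AE boltzmann_bounds)
qed

lemma integral_boltzmann_le_1: "(\<integral>\<theta>. boltzmann \<theta> \<partial>\<pi>) \<le> 1"
proof -
  have "(\<integral>\<theta>. boltzmann \<theta> \<partial>\<pi>) \<le> (\<integral>\<theta>. 1 \<partial>\<pi>)"
    by (intro integral_mono integrable_boltzmann boltzmann_bounds) auto
  then show ?thesis by (simp add: \<pi>.prob_space)
qed

text \<open>
  Apply Donsker--Varadhan, for fixed data, with the density \<open>v = boltzmann / V\<close>. The random
  term \<open>B\<close> is the \<open>v\<close>-average of \<open>ln Z\<^sub>\<theta> + n KL\<close>, which has expectation \<open>0\<close> for every \<open>\<theta>\<close>
  of finite divergence. Fubini applies because \<open>exp (- n k) (2 k + 2)\<close> is bounded in \<open>k\<close>, so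
  the weight \<open>v\<close> tames divergences that are finite but unbounded in \<open>\<theta>\<close>. The same weight shows
  that the evidence is almost surely positive.
\<close>

lemma ln_evidence_lower_bound:
  defines "V \<equiv> (\<integral>\<theta>. boltzmann \<theta> \<partial>\<pi>)"
  assumes V: "0 < V"
  obtains B where "integrable P B" "(\<integral>\<omega>. B \<omega> \<partial>P) = 0"
    "AE \<omega> in P. 0 < evidence \<omega> \<and> ln V + B \<omega> \<le> ln (evidence \<omega>)"
proof -
  define k where "k \<theta> = real_of_ereal (KL \<mu> q (p \<theta>))" for \<theta>
  define l where "l i \<theta> \<omega> = ln (p \<theta> (X i \<omega>) / q (X i \<omega>))" for i \<theta> \<omega>
  define v where "v \<theta> = boltzmann \<theta> / V" for \<theta>
  define F where "F \<theta> \<omega> = v \<theta> * (\<Sum>i<n. l i \<theta> \<omega> + k \<theta>)" for \<theta> \<omega>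
  note [measurable] = lratio_measurable[unfolded split_beta']
  have [measurable]: "k \<in> borel_measurable \<pi>" "v \<in> borel_measurable \<pi>"
    unfolding k_def v_def by measurable
  have l_meas: "(\<lambda>x. l i (fst x) (snd x)) \<in> borel_measurable (\<pi> \<Otimes>\<^sub>M P)" if "i < n" for i
    using p_X_measurable[OF that] q_X_measurable_pair[OF that] unfolding l_def split_beta'
    by measurable
  have F_meas [measurable]: "(\<lambda>x. F (fst x) (snd x)) \<in> borel_measurable (\<pi> \<Otimes>\<^sub>M P)"
    unfolding F_def using l_meas
    by (intro borel_measurable_times borel_measurable_sum borel_measurable_add) auto
  have v: "integrable \<pi> v" "(\<integral>\<theta>. v \<theta> \<partial>\<pi>) = 1" "\<And>\<theta>. \<theta> \<in> space \<pi> \<Longrightarrow> 0 \<le> v \<theta>"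
    using integrable_boltzmann V by (auto simp: v_def[abs_def] V_def boltzmann_bounds)
  have v_pos: "KL \<mu> q (p \<theta>) < \<infinity> \<and> v \<theta> = exp (- (real n * k \<theta>)) / V" if "v \<theta> \<noteq> 0" for \<theta>
    using that by (auto simp: v_def boltzmann_def k_def split: if_splits)
  have k0: "0 \<le> k \<theta>" if "\<theta> \<in> space \<pi>" for \<theta>
    using KL_nonneg[OF q p[OF that]] by (simp add: k_def real_of_ereal_pos)
  have F_bound: "(\<integral>\<^sup>+\<omega>. ennreal (norm (F \<theta> \<omega>)) \<partial>P) \<le> ennreal (real n * (4 / V))"
    and F_int: "(\<integral>\<omega>. F \<theta> \<omega> \<partial>P) = 0" if \<theta>: "\<theta> \<in> space \<pi>" for \<theta>
  proof -
    have l_meas' [measurable]: "l i \<theta> \<in> borel_measurable P" if "i < n" for i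
      using measurable_compose[OF measurable_Pair1'[OF \<theta>] l_meas[OF that]] by simp
    have "(\<integral>\<^sup>+\<omega>. ennreal (norm (F \<theta> \<omega>)) \<partial>P) \<le> ennreal (real n * (4 / V)) \<and> (\<integral>\<omega>. F \<theta> \<omega> \<partial>P) = 0"
    proof (cases "v \<theta> = 0")
      case True
      then show ?thesis by (simp add: F_def)
    next
      case False
      note fin = v_pos[OF False]
      have pm [measurable]: "p \<theta> \<in> borel_measurable \<mu>" using \<theta> by measurable
      have abs_le: "(\<integral>\<^sup>+\<omega>. ennreal \<bar>l i \<theta> \<omega>\<bar> \<partial>P) \<le> ennreal (k \<theta> + 2)" if "i < n" for i
        unfolding l_def k_def
        using nn_integral_X[OF that, of "\<lambda>x. ennreal \<bar>ln (p \<theta> x / q x)\<bar>"]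
          nn_integral_abs_ln_ratio[OF q p[OF \<theta>]] fin by simp
      have l_int: "integrable P (l i \<theta>)" if "i < n" for i
        using abs_le[OF that] that by (intro integrableI_bounded) (auto intro: le_less_trans)
      have l_exp: "(\<integral>\<omega>. l i \<theta> \<omega> \<partial>P) = - k \<theta>" if "i < n" for i
      proof -
        have "(\<integral>\<omega>. l i \<theta> \<omega> \<partial>P) = (\<integral>x. ln (p \<theta> x / q x) \<partial>distr P \<mu> (X i))"
          unfolding l_def using X_measurable[OF that] by (intro integral_distr[symmetric]) auto
        also have "\<dots> = - k \<theta>"
          unfolding distr_X[OF that] k_def using integral_ln_ratio[OF q p[OF \<theta>]] fin by simp
        finally show ?thesis .
      qed
      have "(\<integral>\<omega>. F \<theta> \<omega> \<partial>P) = v \<theta> * (\<Sum>i<n. (\<integral>\<omega>. l i \<theta> \<omega> \<partial>P) + k \<theta>)"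
        unfolding F_def using l_int by (simp add: data.prob_space)
      then have zero: "(\<integral>\<omega>. F \<theta> \<omega> \<partial>P) = 0"
        by (simp add: l_exp)
      have "(\<integral>\<^sup>+\<omega>. ennreal (norm (F \<theta> \<omega>)) \<partial>P)
          \<le> (\<integral>\<^sup>+\<omega>. ennreal (v \<theta>) * (\<Sum>i<n. ennreal \<bar>l i \<theta> \<omega>\<bar> + ennreal (k \<theta>)) \<partial>P)"
      proof (intro nn_integral_mono)
        fix \<omega>
        have "norm (F \<theta> \<omega>) \<le> v \<theta> * (\<Sum>i<n. \<bar>l i \<theta> \<omega>\<bar> + k \<theta>)"
          unfolding F_def real_norm_def abs_mult
          using v(3)[OF \<theta>] k0[OF \<theta>]
          by (intro mult_mono order_trans[OF sum_abs] sum_mono)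
            (auto intro: order_trans[OF abs_triangle_ineq])
        then have "ennreal (norm (F \<theta> \<omega>)) \<le> ennreal (v \<theta> * (\<Sum>i<n. \<bar>l i \<theta> \<omega>\<bar> + k \<theta>))"
          by (rule ennreal_leI)
        also have "\<dots> = ennreal (v \<theta>) * (\<Sum>i<n. ennreal (\<bar>l i \<theta> \<omega>\<bar> + k \<theta>))"
          using v(3)[OF \<theta>] k0[OF \<theta>] by (subst sum_ennreal) (auto simp: ennreal_mult sum_nonneg)
        finally show "ennreal (norm (F \<theta> \<omega>)) \<le> ennreal (v \<theta>) * (\<Sum>i<n. ennreal \<bar>l i \<theta> \<omega>\<bar> + ennreal (k \<theta>))"
          using k0[OF \<theta>] by (simp add: ennreal_plus)
      qed
      also have "\<dots> = ennreal (v \<theta>) * (\<Sum>i<n. (\<integral>\<^sup>+\<omega>. ennreal \<bar>l i \<theta> \<omega>\<bar> \<partial>P) + ennreal (k \<theta>))"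
      proof -
        have "(\<integral>\<^sup>+\<omega>. (\<Sum>i<n. ennreal \<bar>l i \<theta> \<omega>\<bar> + ennreal (k \<theta>)) \<partial>P)
            = (\<Sum>i<n. \<integral>\<^sup>+\<omega>. ennreal \<bar>l i \<theta> \<omega>\<bar> + ennreal (k \<theta>) \<partial>P)"
          by (intro nn_integral_sum) auto
        also have "\<dots> = (\<Sum>i<n. (\<integral>\<^sup>+\<omega>. ennreal \<bar>l i \<theta> \<omega>\<bar> \<partial>P) + ennreal (k \<theta>))"
          by (intro sum.cong refl) (simp add: nn_integral_add data.emeasure_space_1)
        finally have eq: "(\<integral>\<^sup>+\<omega>. (\<Sum>i<n. ennreal \<bar>l i \<theta> \<omega>\<bar> + ennreal (k \<theta>)) \<partial>P)
            = (\<Sum>i<n. (\<integral>\<^sup>+\<omega>. ennreal \<bar>l i \<theta> \<omega>\<bar> \<partial>P) + ennreal (k \<theta>))" .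
        have "(\<lambda>\<omega>. \<Sum>i<n. ennreal \<bar>l i \<theta> \<omega>\<bar> + ennreal (k \<theta>)) \<in> borel_measurable P"
          by (intro borel_measurable_sum) auto
        then show ?thesis
          by (simp only: nn_integral_cmult eq)
      qed
      also have "\<dots> \<le> ennreal (v \<theta>) * (\<Sum>i<n. ennreal (k \<theta> + 2) + ennreal (k \<theta>))"
        by (intro mult_left_mono sum_mono add_mono abs_le) auto
      also have "\<dots> = ennreal (real n * (v \<theta> * (2 * k \<theta> + 2)))"
      proof -
        have "(\<Sum>i<n. ennreal (k \<theta> + 2) + ennreal (k \<theta>)) = (\<Sum>i<n. ennreal (2 * k \<theta> + 2))"
          using k0[OF \<theta>] by (intro sum.cong refl, subst ennreal_plus[symmetric]) auto
        also have "\<dots> = ennreal (\<Sum>i<n. 2 * k \<theta> + 2)"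
          using k0[OF \<theta>] by (intro sum_ennreal) auto
        also have "(\<Sum>i<n. 2 * k \<theta> + 2) = real n * (2 * k \<theta> + 2)"
          by (simp only: sum_constant card_lessThan)
        finally have "ennreal (v \<theta>) * (\<Sum>i<n. ennreal (k \<theta> + 2) + ennreal (k \<theta>))
            = ennreal (v \<theta> * (real n * (2 * k \<theta> + 2)))"
          using v(3)[OF \<theta>] by (simp only: ennreal_mult')
        then show ?thesis
          by (simp only: mult.left_commute)
      qed
      also have "\<dots> \<le> ennreal (real n * (4 / V))"
      proof (intro ennreal_leI mult_left_mono)
        \<comment> \<open>Here \<open>n \<ge> 1\<close> matters: \<open>exp (n k) \<ge> exp k \<ge> 1 + k\<close>.\<close>
        have "k \<theta> \<le> real n * k \<theta>"
          using mult_right_mono[of 1 "real n" "k \<theta>"] n k0[OF \<theta>] by simp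
        then have "1 + k \<theta> \<le> exp (real n * k \<theta>)"
          using exp_ge_add_one_self[of "k \<theta>"] by (meson exp_le_cancel_iff order_trans)
        then have "2 * k \<theta> + 2 \<le> 4 * exp (real n * k \<theta>)"
          using exp_gt_zero[of "real n * k \<theta>"] by linarith
        then have "exp (- (real n * k \<theta>)) * (2 * k \<theta> + 2) \<le> exp (- (real n * k \<theta>)) * (4 * exp (real n * k \<theta>))"
          by (intro mult_left_mono) auto
        also have "\<dots> = 4"
          by (simp add: exp_minus)
        finally have "exp (- (real n * k \<theta>)) * (2 * k \<theta> + 2) / V \<le> 4 / V"
          using V by (intro divide_right_mono) auto
        then show "v \<theta> * (2 * k \<theta> + 2) \<le> 4 / V"
          using fin by simp
      qed auto
      finally show ?thesis using zero by simp
    qed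
    then show "(\<integral>\<^sup>+\<omega>. ennreal (norm (F \<theta> \<omega>)) \<partial>P) \<le> ennreal (real n * (4 / V))"
      "(\<integral>\<omega>. F \<theta> \<omega> \<partial>P) = 0" by auto
  qed
  have F_integrable: "integrable (\<pi> \<Otimes>\<^sub>M P) (case_prod F)"
  proof (rule integrableI_bounded)
    show "case_prod F \<in> borel_measurable (\<pi> \<Otimes>\<^sub>M P)"
      using F_meas by (simp add: split_beta')
    have "(\<integral>\<^sup>+x. ennreal (norm (case_prod F x)) \<partial>(\<pi> \<Otimes>\<^sub>M P)) = (\<integral>\<^sup>+\<theta>. \<integral>\<^sup>+\<omega>. ennreal (norm (F \<theta> \<omega>)) \<partial>P \<partial>\<pi>)"
      using data.nn_integral_fst[of "\<lambda>x. ennreal (norm (F (fst x) (snd x)))" \<pi>] by (simp add: split_beta')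
    also have "\<dots> \<le> (\<integral>\<^sup>+\<theta>. ennreal (real n * (4 / V)) \<partial>\<pi>)"
      by (intro nn_integral_mono F_bound)
    also have "\<dots> < \<infinity>"
      by (simp add: \<pi>.emeasure_space_1)
    finally show "(\<integral>\<^sup>+x. ennreal (norm (case_prod F x)) \<partial>(\<pi> \<Otimes>\<^sub>M P)) < \<infinity>" .
  qed
  define B where "B \<omega> = (\<integral>\<theta>. F \<theta> \<omega> \<partial>\<pi>)" for \<omega>
  have B: "integrable P B"
    unfolding B_def[abs_def] using F_integrable by (rule integrable_snd)
  have "(\<integral>\<omega>. B \<omega> \<partial>P) = (\<integral>\<theta>. \<integral>\<omega>. F \<theta> \<omega> \<partial>P \<partial>\<pi>)"
    unfolding B_def by (rule Fubini_integral[OF F_integrable])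
  also have "\<dots> = (\<integral>\<theta>. 0 \<partial>\<pi>)"
    by (intro Bochner_Integration.integral_cong refl F_int)
  finally have B0: "(\<integral>\<omega>. B \<omega> \<partial>P) = 0" by simp
  have "AE \<theta> in \<pi>. AE \<omega> in P. \<forall>i\<in>{..<n}. 0 < v \<theta> \<longrightarrow> 0 < p \<theta> (X i \<omega>)"
  proof (rule AE_I2)
    fix \<theta> assume \<theta>: "\<theta> \<in> space \<pi>"
    show "AE \<omega> in P. \<forall>i\<in>{..<n}. 0 < v \<theta> \<longrightarrow> 0 < p \<theta> (X i \<omega>)"
    proof (cases "0 < v \<theta>")
      case True
      then have "AE x in Q. 0 < p \<theta> x"
        using v_pos[of \<theta>] by (intro AE_pos_of_KL_finite q p \<theta>) auto
      then show ?thesis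
        by (intro AE_finite_allI) (auto dest: AE_X simp del: AE_density)
    qed auto
  qed
  moreover have "{x \<in> space (\<pi> \<Otimes>\<^sub>M P). \<forall>i\<in>{..<n}. 0 < v (fst x) \<longrightarrow> 0 < p (fst x) (X i (snd x))}
      \<in> sets (\<pi> \<Otimes>\<^sub>M P)"
  proof (intro sets.sets_Collect_finite_All)
    fix i assume "i \<in> {..<n}"
    then have [measurable]: "(\<lambda>x. p (fst x) (X i (snd x))) \<in> borel_measurable (\<pi> \<Otimes>\<^sub>M P)"
      using p_X_measurable[of i] by (simp add: split_beta')
    show "{x \<in> space (\<pi> \<Otimes>\<^sub>M P). 0 < v (fst x) \<longrightarrow> 0 < p (fst x) (X i (snd x))} \<in> sets (\<pi> \<Otimes>\<^sub>M P)"
      by measurable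
  qed auto
  ultimately have p_pos: "AE \<omega> in P. AE \<theta> in \<pi>. \<forall>i\<in>{..<n}. 0 < v \<theta> \<longrightarrow> 0 < p \<theta> (X i \<omega>)"
    by (subst (asm) AE_commute) auto
  have "AE \<omega> in P. 0 < evidence \<omega> \<and> ln V + B \<omega> \<le> ln (evidence \<omega>)"
    using AE_integrable_lratio p_pos AE_q_pos AE_integrable_snd[OF F_integrable] AE_space
  proof eventually_elim
    case (elim \<omega>)
    have Z0: "AE \<theta> in \<pi>. 0 \<le> lratio \<theta> \<omega>"
      using elim by (intro AE_I2 lratio_nonneg)
    have lratio_pos: "AE \<theta> in \<pi>. 0 < v \<theta> \<longrightarrow> 0 < lratio \<theta> \<omega> \<and> ln (lratio \<theta> \<omega>) = (\<Sum>i<n. l i \<theta> \<omega>)"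
      using elim(2)
    proof eventually_elim
      case (elim \<theta>)
      show ?case
      proof
        assume "0 < v \<theta>"
        then have pq: "0 < p \<theta> (X i \<omega>)" "0 < q (X i \<omega>)" if "i < n" for i
          using elim \<open>\<forall>i\<in>{..<n}. 0 < q (X i \<omega>)\<close> that by auto
        then show "0 < lratio \<theta> \<omega> \<and> ln (lratio \<theta> \<omega>) = (\<Sum>i<n. l i \<theta> \<omega>)"
          unfolding lratio_def l_def
          by (intro conjI prod_pos ln_prod)
            (auto simp: pq less_imp_neq[OF pq(1), symmetric] less_imp_neq[OF pq(2), symmetric])
      qed
    qed
    have ev: "0 < evidence \<omega>"
    proof (rule ccontr)
      assume "\<not> 0 < evidence \<omega>"
      then have "evidence \<omega> = 0"
        using integral_nonneg_AE[OF Z0] by (simp add: evidence_def)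
      then have "AE \<theta> in \<pi>. lratio \<theta> \<omega> = 0"
        using integral_nonneg_eq_0_iff_AE[OF elim(1) Z0] by (simp add: evidence_def)
      then have "AE \<theta> in \<pi>. v \<theta> = 0"
        using lratio_pos AE_space by eventually_elim (auto dest: v(3) simp: less_le)
      then have "(\<integral>\<theta>. v \<theta> \<partial>\<pi>) = (\<integral>\<theta>. 0 \<partial>\<pi>)"
        by (intro integral_cong_AE) auto
      then show False using v(2) by simp
    qed
    define g where "g \<theta> = (\<Sum>i<n. l i \<theta> \<omega> + k \<theta>) + ln V" for \<theta>
    have vg: "(\<lambda>\<theta>. v \<theta> * g \<theta>) = (\<lambda>\<theta>. F \<theta> \<omega> + v \<theta> * ln V)"
      by (auto simp: g_def F_def algebra_simps)
    have "(\<integral>\<theta>. v \<theta> * g \<theta> \<partial>\<pi>) \<le> ln (\<integral>\<theta>. lratio \<theta> \<omega> \<partial>\<pi>)"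
    proof (rule \<pi>.integral_ln_ratio_le_ln_integral)
      show "integrable \<pi> (\<lambda>\<theta>. v \<theta> * g \<theta>)"
        unfolding vg using elim(4) v by auto
      show "AE \<theta> in \<pi>. 0 < v \<theta> \<longrightarrow> 0 < lratio \<theta> \<omega> \<and> g \<theta> = ln (lratio \<theta> \<omega>) - ln (v \<theta>)"
        using lratio_pos
      proof eventually_elim
        case (elim \<theta>)
        show ?case
        proof
          assume pos: "0 < v \<theta>"
          then have "ln (v \<theta>) = - (real n * k \<theta>) - ln V"
            using v_pos[of \<theta>] V by (simp add: ln_div)
          then show "0 < lratio \<theta> \<omega> \<and> g \<theta> = ln (lratio \<theta> \<omega>) - ln (v \<theta>)"
            using elim pos by (simp add: g_def sum.distrib)
        qed
      qed
    qed (use v elim Z0 ev in \<open>auto simp: evidence_def\<close>)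
    also have "(\<integral>\<theta>. v \<theta> * g \<theta> \<partial>\<pi>) = B \<omega> + ln V"
      unfolding vg B_def using elim(4) v by simp
    finally show ?case
      using ev by (simp add: evidence_def)
  qed
  with B B0 show ?thesis by (rule that)
qed

section \<open>Sum over the cover\<close>

text \<open>
  The cells may overlap, so the integral over the parameter space is bounded by the sum of the
  integrals over the cells; each cell is then handled for fixed data, and the expectation of the
  product of suprema factorises by independence.
\<close>

lemma nn_integral_evidence_cover_le:
  fixes \<Gamma> :: "'j \<Rightarrow> 't set"
  assumes J: "countable J" and \<Gamma>: "\<And>j. j \<in> J \<Longrightarrow> \<Gamma> j \<in> sets \<pi>" and cover: "space \<pi> \<subseteq> (\<Union>j\<in>J. \<Gamma> j)"
    and sup: "\<And>j. j \<in> J \<Longrightarrow> (\<lambda>x. SUP \<theta>\<in>\<Gamma> j. ennreal (p \<theta> x)) \<in> borel_measurable \<mu>"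
    and a: "0 \<le> a" "a < 1" and ev: "AE \<omega> in P. 0 < evidence \<omega>"
  shows "(\<integral>\<^sup>+\<omega>. \<integral>\<^sup>+\<theta>. ennreal (lratio \<theta> \<omega> * (lratio \<theta> \<omega> / evidence \<omega>) powr (1 - a)) \<partial>\<pi> \<partial>P)
    \<le> (\<integral>\<^sup>+j. ennreal (rpow (measure \<pi> (\<Gamma> j)) a)
        * (\<integral>\<^sup>+x. (SUP \<theta>\<in>\<Gamma> j. ennreal (p \<theta> x)) \<partial>\<mu>) ^ n \<partial>count_space J)"
proof -
  define s where "s j x = (SUP \<theta>\<in>\<Gamma> j. ennreal (p \<theta> x)) / ennreal (q x)" for j x
  have s_meas: "s j \<in> borel_measurable \<mu>" if "j \<in> J" for j
    using sup[OF that] unfolding s_def by measurable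
  have S_meas: "(\<lambda>\<omega>. \<Prod>i<n. s j (X i \<omega>)) \<in> borel_measurable P" if "j \<in> J" for j
    using measurable_compose[OF X_measurable s_meas[OF that]] by (intro borel_measurable_prod_ennreal) auto
  have "(\<integral>\<^sup>+\<omega>. \<integral>\<^sup>+\<theta>. ennreal (lratio \<theta> \<omega> * (lratio \<theta> \<omega> / evidence \<omega>) powr (1 - a)) \<partial>\<pi> \<partial>P)
     \<le> (\<integral>\<^sup>+\<omega>. \<integral>\<^sup>+j. ennreal (rpow (measure \<pi> (\<Gamma> j)) a) * (\<Prod>i<n. s j (X i \<omega>)) \<partial>count_space J \<partial>P)"
  proof (intro nn_integral_mono_AE)
    show "AE \<omega> in P. (\<integral>\<^sup>+\<theta>. ennreal (lratio \<theta> \<omega> * (lratio \<theta> \<omega> / evidence \<omega>) powr (1 - a)) \<partial>\<pi>)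
      \<le> (\<integral>\<^sup>+j. ennreal (rpow (measure \<pi> (\<Gamma> j)) a) * (\<Prod>i<n. s j (X i \<omega>)) \<partial>count_space J)"
      using ev AE_integrable_lratio AE_q_pos AE_space
    proof eventually_elim
      case (elim \<omega>)
      let ?h = "\<lambda>\<theta>. ennreal (lratio \<theta> \<omega> * (lratio \<theta> \<omega> / evidence \<omega>) powr (1 - a))"
      have h: "?h \<in> borel_measurable \<pi>"
        using elim(4) by measurable
      have "(\<integral>\<^sup>+\<theta>. ?h \<theta> \<partial>\<pi>) \<le> (\<integral>\<^sup>+\<theta>. \<integral>\<^sup>+j. ?h \<theta> * indicator (\<Gamma> j) \<theta> \<partial>count_space J \<partial>\<pi>)"
      proof (intro nn_integral_mono)
        fix \<theta> assume "\<theta> \<in> space \<pi>"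
        then obtain j where j: "j \<in> J" "\<theta> \<in> \<Gamma> j" using cover by auto
        have "?h \<theta> = ?h \<theta> * indicator (\<Gamma> j) \<theta>" using j by simp
        also have "\<dots> \<le> (\<integral>\<^sup>+j. ?h \<theta> * indicator (\<Gamma> j) \<theta> \<partial>count_space J)"
          using j by (intro nn_integral_ge_point)
        finally show "?h \<theta> \<le> (\<integral>\<^sup>+j. ?h \<theta> * indicator (\<Gamma> j) \<theta> \<partial>count_space J)" .
      qed
      also have "\<dots> = (\<integral>\<^sup>+j. \<integral>\<^sup>+\<theta>. ?h \<theta> * indicator (\<Gamma> j) \<theta> \<partial>\<pi> \<partial>count_space J)"
        by (intro nn_integral_count_space_nn_integral J borel_measurable_times_ennreal h
            borel_measurable_indicator \<Gamma>)
      also have "\<dots> \<le> (\<integral>\<^sup>+j. ennreal (rpow (measure \<pi> (\<Gamma> j)) a) * (\<Prod>i<n. s j (X i \<omega>)) \<partial>count_space J)"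
      proof (intro nn_integral_mono)
        fix j assume "j \<in> space (count_space J)"
        then have j: "j \<in> J" by simp
        show "(\<integral>\<^sup>+\<theta>. ?h \<theta> * indicator (\<Gamma> j) \<theta> \<partial>\<pi>)
            \<le> ennreal (rpow (measure \<pi> (\<Gamma> j)) a) * (\<Prod>i<n. s j (X i \<omega>))"
        proof (rule \<pi>.nn_integral_cell_le)
          fix \<theta> assume \<theta>: "\<theta> \<in> \<Gamma> j"
          then have \<theta>': "\<theta> \<in> space \<pi>"
            using \<Gamma>[OF j] sets.sets_into_space by auto
          have "ennreal (lratio \<theta> \<omega>) = (\<Prod>i<n. ennreal (p \<theta> (X i \<omega>) / q (X i \<omega>)))"
            unfolding lratio_def using \<theta>' elim by (intro prod_ennreal[symmetric] ratio_X_nonneg) auto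
          also have "\<dots> \<le> (\<Prod>i<n. s j (X i \<omega>))"
          proof (intro prod_mono_ennreal)
            fix i assume "i \<in> {..<n}"
            then have qi: "0 < q (X i \<omega>)" and "X i \<omega> \<in> space \<mu>"
              using elim measurable_space[OF X_measurable] by auto
            then have "0 \<le> p \<theta> (X i \<omega>)"
              using p[OF \<theta>'] by (auto simp: prob_density_def)
            then have "ennreal (p \<theta> (X i \<omega>) / q (X i \<omega>)) = ennreal (p \<theta> (X i \<omega>)) / ennreal (q (X i \<omega>))"
              using qi by (simp add: divide_ennreal)
            also have "\<dots> \<le> s j (X i \<omega>)"
              unfolding s_def using \<theta> by (intro divide_right_mono_ennreal SUP_upper)
            finally show "ennreal (p \<theta> (X i \<omega>) / q (X i \<omega>)) \<le> s j (X i \<omega>)" .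
          qed
          finally show "ennreal (lratio \<theta> \<omega>) \<le> (\<Prod>i<n. s j (X i \<omega>))" .
        qed (use elim a \<Gamma>[OF j] in \<open>auto simp: evidence_def lratio_nonneg\<close>)
      qed
      finally show ?case .
    qed
  qed
  also have "\<dots> = (\<integral>\<^sup>+j. \<integral>\<^sup>+\<omega>. ennreal (rpow (measure \<pi> (\<Gamma> j)) a) * (\<Prod>i<n. s j (X i \<omega>)) \<partial>P \<partial>count_space J)"
    using S_meas by (intro nn_integral_count_space_nn_integral J) auto
  also have "\<dots> \<le> (\<integral>\<^sup>+j. ennreal (rpow (measure \<pi> (\<Gamma> j)) a)
        * (\<integral>\<^sup>+x. (SUP \<theta>\<in>\<Gamma> j. ennreal (p \<theta> x)) \<partial>\<mu>) ^ n \<partial>count_space J)"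
  proof (intro nn_integral_mono)
    fix j assume "j \<in> space (count_space J)"
    then have j: "j \<in> J" by simp
    have "(\<integral>\<^sup>+\<omega>. ennreal (rpow (measure \<pi> (\<Gamma> j)) a) * (\<Prod>i<n. s j (X i \<omega>)) \<partial>P)
        = ennreal (rpow (measure \<pi> (\<Gamma> j)) a) * (\<integral>\<^sup>+x. s j x \<partial>Q) ^ n"
      using S_meas[OF j] by (simp add: nn_integral_cmult nn_integral_prod_X s_meas[OF j])
    also have "\<dots> \<le> ennreal (rpow (measure \<pi> (\<Gamma> j)) a) * (\<integral>\<^sup>+x. (SUP \<theta>\<in>\<Gamma> j. ennreal (p \<theta> x)) \<partial>\<mu>) ^ n"
      unfolding s_def using sup[OF j]
      by (intro mult_left_mono power_mono nn_integral_density_ratio_le) auto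
    finally show "(\<integral>\<^sup>+\<omega>. ennreal (rpow (measure \<pi> (\<Gamma> j)) a) * (\<Prod>i<n. s j (X i \<omega>)) \<partial>P) \<le> \<dots>" .
  qed
  finally show ?thesis .
qed

section \<open>Posterior risk\<close>

text \<open>
  Numerator and denominator of the posterior density share the factor \<open>\<Prod>\<^sub>i q(X\<^sub>i)\<close>, almost
  surely positive.
\<close>

lemma posterior_eq:
  assumes \<omega>: "\<omega> \<in> space P" "\<forall>i\<in>{..<n}. 0 < q (X i \<omega>)"
    and ratio: "integrable \<pi> (\<lambda>\<theta>. lratio \<theta> \<omega>)" "0 < evidence \<omega>"
  shows "posterior \<pi> p n (\<lambda>i. X i \<omega>) \<theta> = ereal (lratio \<theta> \<omega> / evidence \<omega>)"
proof -
  define c where "c = (\<Prod>i<n. q (X i \<omega>))"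
  have c: "0 < c" using \<omega> by (auto simp: c_def intro: prod_pos)
  have lik: "(\<Prod>i<n. p \<theta> (X i \<omega>)) = lratio \<theta> \<omega> * c" for \<theta>
    using c by (simp add: lratio_def prod_dividef flip: c_def)
  have "eintegral \<pi> (\<lambda>\<theta>'. ereal (\<Prod>i<n. p \<theta>' (X i \<omega>)))
      = enn2ereal (\<integral>\<^sup>+\<theta>. ennreal (lratio \<theta> \<omega> * c) \<partial>\<pi>)"
    using \<omega> c by (subst eintegral_nonneg) (auto simp: lik lratio_nonneg)
  also have "(\<integral>\<^sup>+\<theta>. ennreal (lratio \<theta> \<omega> * c) \<partial>\<pi>) = ennreal (evidence \<omega> * c)"
    using \<omega> c ratio by (subst nn_integral_eq_integral) (auto simp: lratio_nonneg evidence_def)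
  finally show ?thesis
    using c ratio by (simp add: posterior_def lik)
qed

lemma one_plus_r_ub: "1 + r_ub \<mu> p A = enn2ereal (\<integral>\<^sup>+x. (SUP \<theta>\<in>A. ennreal (p \<theta> x)) \<partial>\<mu>)"
proof -
  have "1 + (enn2ereal x - 1) = enn2ereal x" for x
    by (cases x) (simp_all add: one_ereal_def)
  then show ?thesis
    by (simp only: r_ub_def)
qed

lemma cover_term_eq:
  "ereal (rpow (measure \<pi> A) a) * (1 + r_ub \<mu> p A) ^ n
     = enn2ereal (ennreal (rpow (measure \<pi> A) a) * (\<integral>\<^sup>+x. (SUP \<theta>\<in>A. ennreal (p \<theta> x)) \<partial>\<mu>) ^ n)"
proof -
  have "enn2ereal (x ^ k) = enn2ereal x ^ k" for x and k :: nat
    by (induction k) (auto simp: one_ennreal.rep_eq times_ennreal.rep_eq)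
  then show ?thesis
    by (simp add: one_plus_r_ub times_ennreal.rep_eq enn2ereal_ennreal rpow_def)
qed

lemma one_le_integral_SUP:
  assumes "\<theta> \<in> A" "A \<in> sets \<pi>"
  shows "1 \<le> (\<integral>\<^sup>+x. (SUP \<theta>\<in>A. ennreal (p \<theta> x)) \<partial>\<mu>)"
proof -
  have "1 = (\<integral>\<^sup>+x. ennreal (p \<theta> x) \<partial>\<mu>)"
    using p[of \<theta>] sets.sets_into_space[OF assms(2)] assms(1) by (simp add: prob_density_def subset_iff)
  also have "\<dots> \<le> (\<integral>\<^sup>+x. (SUP \<theta>\<in>A. ennreal (p \<theta> x)) \<partial>\<mu>)"
    using assms by (intro nn_integral_mono SUP_upper)
  finally show ?thesis .
qed

text \<open>
  Some cell has positive prior mass, hence is nonempty and has bracketing integral at least 1.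
  This makes the logarithm of the sum different from \<open>- \<infinity>\<close>.
\<close>

lemma cover_sum_pos:
  fixes \<Gamma> :: "'j \<Rightarrow> 't set"
  assumes cover: "countable_cover \<pi> J \<Gamma>"
  shows "0 < (\<Sum>\<^sub>\<infinity>j\<in>J. ereal (rpow (measure \<pi> (\<Gamma> j)) a) * (1 + r_ub \<mu> p (\<Gamma> j)) ^ n)"
proof -
  have J: "countable J" "\<And>j. j \<in> J \<Longrightarrow> \<Gamma> j \<in> sets \<pi>" "(\<Union>j\<in>J. \<Gamma> j) = space \<pi>"
    using cover by (auto simp: countable_cover_def)
  have "\<exists>j\<in>J. measure \<pi> (\<Gamma> j) \<noteq> 0"
  proof (rule ccontr)
    assume "\<not> ?thesis"
    then have "\<Gamma> j \<in> null_sets \<pi>" if "j \<in> J" for j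
      using that J by (auto simp: \<pi>.emeasure_eq_measure intro!: null_setsI)
    then have "(\<Union>j\<in>J. \<Gamma> j) \<in> null_sets \<pi>"
      using J(1) by (intro null_sets_UN') auto
    then show False
      using J \<pi>.emeasure_space_1 by (simp add: null_sets_def)
  qed
  then obtain j where j: "j \<in> J" "measure \<pi> (\<Gamma> j) \<noteq> 0" by auto
  then have "\<Gamma> j \<noteq> {}" by auto
  then obtain \<theta> where "\<theta> \<in> \<Gamma> j" by auto
  then have "1 \<le> (\<integral>\<^sup>+x. (SUP \<theta>\<in>\<Gamma> j. ennreal (p \<theta> x)) \<partial>\<mu>) ^ n"
    using j J by (intro one_le_power one_le_integral_SUP) auto
  then have "0 < (\<integral>\<^sup>+x. (SUP \<theta>\<in>\<Gamma> j. ennreal (p \<theta> x)) \<partial>\<mu>) ^ n"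
    by (rule less_le_trans[OF zero_less_one])
  moreover have "0 < ennreal (rpow (measure \<pi> (\<Gamma> j)) a)"
    using j(2) measure_nonneg[of \<pi> "\<Gamma> j"] by (cases "a = 0") (simp_all add: rpow_def)
  ultimately have "0 < ennreal (rpow (measure \<pi> (\<Gamma> j)) a) * (\<integral>\<^sup>+x. (SUP \<theta>\<in>\<Gamma> j. ennreal (p \<theta> x)) \<partial>\<mu>) ^ n"
    by (simp only: ennreal_zero_less_mult_iff simp_thms)
  then have "0 < enn2ereal (ennreal (rpow (measure \<pi> (\<Gamma> j)) a) * (\<integral>\<^sup>+x. (SUP \<theta>\<in>\<Gamma> j. ennreal (p \<theta> x)) \<partial>\<mu>) ^ n)"
    by (simp add: less_ennreal.rep_eq zero_ennreal.rep_eq)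
  also have "\<dots> \<le> (\<Sum>\<^sub>\<infinity>j\<in>J. ereal (rpow (measure \<pi> (\<Gamma> j)) a) * (1 + r_ub \<mu> p (\<Gamma> j)) ^ n)"
    unfolding cover_term_eq using j(1) by (rule le_infsum_enn2ereal)
  finally show ?thesis .
qed

text \<open>
  The case of a finite right-hand side. Almost surely the inner integral is at most a real
  random variable \<open>G\<close> that is integrable, and whose expectation is computed term by term.
\<close>

lemma expected_posterior_risk_le:
  fixes \<Gamma> :: "'j \<Rightarrow> 't set" and \<rho> \<gamma> :: real
  assumes cover: "countable_cover \<pi> J \<Gamma>"
    and sup: "\<And>j. j \<in> J \<Longrightarrow> (\<lambda>x. SUP \<theta>\<in>\<Gamma> j. ennreal (p \<theta> x)) \<in> borel_measurable \<mu>"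
    and \<rho>: "0 < \<rho>" "\<rho> < 1" and \<gamma>: "1 \<le> \<gamma>" and a: "a = (\<gamma> - 1) / (\<gamma> - \<rho>)"
    and V: "V = (\<integral>\<theta>. boltzmann \<theta> \<partial>\<pi>)" "0 < V"
    and c: "(\<Sum>\<^sub>\<infinity>j\<in>J. ereal (rpow (measure \<pi> (\<Gamma> j)) a) * (1 + r_ub \<mu> p (\<Gamma> j)) ^ n) = ereal c" "0 < c"
  shows "eintegral P (\<lambda>\<omega>. eintegral \<pi> (\<lambda>\<theta>.
             posterior \<pi> p n (\<lambda>i. X i \<omega>) \<theta> * renyi \<rho> \<mu> q (p \<theta>)))
         \<le> ereal (((\<gamma> - \<rho>) * ln c - \<gamma> * ln V) / (\<rho> * (1 - \<rho>) * real n))"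
proof -
  define \<kappa> where "\<kappa> = \<rho> * (1 - \<rho>) * real n"
  have \<kappa>: "0 < \<kappa>" using \<rho> n by (simp add: \<kappa>_def)
  have gr: "0 < \<gamma> - \<rho>" using \<rho> \<gamma> by simp
  have a01: "0 \<le> a" "a < 1" using \<rho> \<gamma> by (auto simp: a)
  have J: "countable J" "\<And>j. j \<in> J \<Longrightarrow> \<Gamma> j \<in> sets \<pi>" "space \<pi> \<subseteq> (\<Union>j\<in>J. \<Gamma> j)"
    using cover by (auto simp: countable_cover_def)
  obtain B where B: "integrable P B" "(\<integral>\<omega>. B \<omega> \<partial>P) = 0"
    and ev: "AE \<omega> in P. 0 < evidence \<omega> \<and> ln V + B \<omega> \<le> ln (evidence \<omega>)"
    using ln_evidence_lower_bound V by auto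
  define A where "A \<theta> = affinity \<rho> \<mu> q (p \<theta>)" for \<theta>
  have A [measurable]: "A \<in> borel_measurable \<pi>"
    unfolding A_def by measurable
  have A0: "0 \<le> A \<theta>" and A1: "A \<theta> \<le> 1" if "\<theta> \<in> space \<pi>" for \<theta>
    unfolding A_def by (intro affinity_nonneg affinity_le_1 q p that \<rho>)+
  define U where "U \<omega> = (\<integral>\<^sup>+\<theta>. ennreal (lratio \<theta> \<omega> powr \<rho>) / ennreal (A \<theta> ^ n) \<partial>\<pi>)" for \<omega>
  define T where "T \<omega> = (\<integral>\<^sup>+\<theta>. ennreal (lratio \<theta> \<omega> * (lratio \<theta> \<omega> / evidence \<omega>) powr (1 - a)) \<partial>\<pi>)" for \<omega>
  have [measurable]: "(\<lambda>x. lratio (snd x) (fst x)) \<in> borel_measurable (P \<Otimes>\<^sub>M \<pi>)"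
    using measurable_pair_swap[OF lratio_measurable] by (simp add: split_beta')
  have [measurable]: "U \<in> borel_measurable P" "T \<in> borel_measurable P"
    unfolding U_def[abs_def] T_def[abs_def] by measurable
  have U_le: "(\<integral>\<^sup>+\<omega>. U \<omega> \<partial>P) \<le> ennreal 1"
    unfolding U_def A_def using nn_integral_normalised_powr_le_1[OF \<rho>] by simp
  have "(\<integral>\<^sup>+\<omega>. T \<omega> \<partial>P) \<le> (\<integral>\<^sup>+j. ennreal (rpow (measure \<pi> (\<Gamma> j)) a)
        * (\<integral>\<^sup>+x. (SUP \<theta>\<in>\<Gamma> j. ennreal (p \<theta> x)) \<partial>\<mu>) ^ n \<partial>count_space J)"
    unfolding T_def using ev by (intro nn_integral_evidence_cover_le J sup a01) auto
  also have "\<dots> \<le> e2ennreal (ereal c)"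
    unfolding c(1)[symmetric] cover_term_eq by (intro nn_integral_count_space_le_infsum J)
  finally have T_le: "(\<integral>\<^sup>+\<omega>. T \<omega> \<partial>P) \<le> ennreal c" by simp
  note U = integrable_enn2real[OF \<open>U \<in> _\<close> U_le zero_le_one]
    integral_enn2real_le[OF \<open>U \<in> _\<close> U_le zero_le_one]
    AE_finite_of_nn_integral_le[OF \<open>U \<in> _\<close> U_le zero_le_one]
  note T = integrable_enn2real[OF \<open>T \<in> _\<close> T_le less_imp_le[OF c(2)]]
    integral_enn2real_le[OF \<open>T \<in> _\<close> T_le less_imp_le[OF c(2)]]
    AE_finite_of_nn_integral_le[OF \<open>T \<in> _\<close> T_le less_imp_le[OF c(2)]]
  define G where "G \<omega> = (enn2real (U \<omega>) - 1 + (\<gamma> - \<rho>) * (enn2real (T \<omega>) / c - 1 + ln c)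
      - \<gamma> * (ln V + B \<omega>)) / \<kappa>" for \<omega>
  have G: "integrable P G"
    unfolding G_def[abs_def] using U(1) T(1) B(1) by auto
  have "(\<integral>\<omega>. G \<omega> \<partial>P) = ((\<integral>\<omega>. enn2real (U \<omega>) \<partial>P) - 1
      + (\<gamma> - \<rho>) * ((\<integral>\<omega>. enn2real (T \<omega>) \<partial>P) / c - 1 + ln c) - \<gamma> * ln V) / \<kappa>"
    unfolding G_def using U(1) T(1) B by (simp add: data.prob_space)
  also have "\<dots> \<le> (1 - 1 + (\<gamma> - \<rho>) * (c / c - 1 + ln c) - \<gamma> * ln V) / \<kappa>"
    by (intro divide_right_mono diff_right_mono add_mono mult_left_mono U(2) T(2) order_refl
        less_imp_le[OF c(2)] less_imp_le[OF gr] less_imp_le[OF \<kappa>])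
  also have "\<dots> = ((\<gamma> - \<rho>) * ln c - \<gamma> * ln V) / \<kappa>"
    using c(2) by simp
  finally have G_le: "(\<integral>\<omega>. G \<omega> \<partial>P) \<le> ((\<gamma> - \<rho>) * ln c - \<gamma> * ln V) / \<kappa>" .
  have inner: "AE \<omega> in P. 0 \<le> G \<omega> \<and> e2ennreal (eintegral \<pi> (\<lambda>\<theta>.
             posterior \<pi> p n (\<lambda>i. X i \<omega>) \<theta> * renyi \<rho> \<mu> q (p \<theta>))) \<le> ennreal (G \<omega>)"
  proof -
    show ?thesis
      using U(3) T(3) ev AE_integrable_lratio AE_q_pos AE_space
    proof eventually_elim
      case (elim \<omega>)
      define R where "R = (enn2real (U \<omega>) - 1 + (\<gamma> - \<rho>) * (enn2real (T \<omega>) / c - 1 + ln c)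
          - \<gamma> * ln (evidence \<omega>)) / (\<rho> * (1 - \<rho>) * real n)"
      have risk: "0 \<le> R" "(\<integral>\<^sup>+\<theta>. e2ennreal (ereal (lratio \<theta> \<omega> / evidence \<omega>) *
            (if A \<theta> = 0 then \<infinity> else ereal (- ln (A \<theta>) / (\<rho> * (1 - \<rho>))))) \<partial>\<pi>) \<le> ennreal R"
        unfolding R_def
        by (rule \<pi>.posterior_risk_le[OF elim(4) lratio_nonneg[OF _ elim(6)] A A0 A1 evidence_def
            conjunct1[OF elim(3)] n c(2) \<rho> \<gamma> a U_def elim(1) T_def elim(2)]; assumption?)+
      have "R \<le> G \<omega>"
        unfolding R_def G_def \<kappa>_def[symmetric] using elim \<kappa> \<gamma>
        by (intro divide_right_mono diff_left_mono mult_left_mono) auto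
      have "e2ennreal (eintegral \<pi> (\<lambda>\<theta>. posterior \<pi> p n (\<lambda>i. X i \<omega>) \<theta> * renyi \<rho> \<mu> q (p \<theta>)))
         \<le> e2ennreal (enn2ereal (\<integral>\<^sup>+\<theta>. e2ennreal (posterior \<pi> p n (\<lambda>i. X i \<omega>) \<theta> * renyi \<rho> \<mu> q (p \<theta>)) \<partial>\<pi>))"
        by (intro e2ennreal_mono eintegral_le)
      also have "\<dots> = (\<integral>\<^sup>+\<theta>. e2ennreal (ereal (lratio \<theta> \<omega> / evidence \<omega>) *
            (if A \<theta> = 0 then \<infinity> else ereal (- ln (A \<theta>) / (\<rho> * (1 - \<rho>))))) \<partial>\<pi>)"
        unfolding e2ennreal_enn2ereal
      proof (intro nn_integral_cong)
        fix \<theta> assume \<theta>: "\<theta> \<in> space \<pi>"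
        show "e2ennreal (posterior \<pi> p n (\<lambda>i. X i \<omega>) \<theta> * renyi \<rho> \<mu> q (p \<theta>))
          = e2ennreal (ereal (lratio \<theta> \<omega> / evidence \<omega>) *
            (if A \<theta> = 0 then \<infinity> else ereal (- ln (A \<theta>) / (\<rho> * (1 - \<rho>)))))"
          unfolding A_def posterior_eq[OF elim(6,5,4) conjunct1[OF elim(3)]] renyi_eq[OF q p[OF \<theta>] \<rho>] ..
      qed
      also have "\<dots> \<le> ennreal (G \<omega>)"
        by (rule order_trans[OF risk(2) ennreal_leI[OF \<open>R \<le> G \<omega>\<close>]])
      finally show ?case
        using risk(1) \<open>R \<le> G \<omega>\<close> by (intro conjI) (rule order_trans)
    qed
  qed
  have "eintegral P (\<lambda>\<omega>. eintegral \<pi> (\<lambda>\<theta>. posterior \<pi> p n (\<lambda>i. X i \<omega>) \<theta> * renyi \<rho> \<mu> q (p \<theta>)))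
      \<le> enn2ereal (\<integral>\<^sup>+\<omega>. e2ennreal (eintegral \<pi> (\<lambda>\<theta>. posterior \<pi> p n (\<lambda>i. X i \<omega>) \<theta> * renyi \<rho> \<mu> q (p \<theta>))) \<partial>P)"
    by (rule eintegral_le)
  also have "\<dots> \<le> enn2ereal (\<integral>\<^sup>+\<omega>. ennreal (G \<omega>) \<partial>P)"
    using inner by (intro iffD1[OF less_eq_ennreal.rep_eq] nn_integral_mono_AE) auto
  also have "(\<integral>\<^sup>+\<omega>. ennreal (G \<omega>) \<partial>P) = ennreal (\<integral>\<omega>. G \<omega> \<partial>P)"
    using G inner by (intro nn_integral_eq_integral) auto
  also have "enn2ereal (ennreal (\<integral>\<omega>. G \<omega> \<partial>P)) = ereal (\<integral>\<omega>. G \<omega> \<partial>P)"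
    using inner by (intro enn2ereal_ennreal integral_nonneg_AE) auto
  also have "\<dots> \<le> ereal (((\<gamma> - \<rho>) * ln c - \<gamma> * ln V) / \<kappa>)"
    using G_le by simp
  finally show ?thesis by (simp add: \<kappa>_def)
qed

end

theorem theorem5p2:
  fixes \<mu> :: "'a measure" and q :: "'a \<Rightarrow> real"
    and \<pi> :: "'t measure" and p :: "'t \<Rightarrow> 'a \<Rightarrow> real"
    and P :: "'w measure" and X :: "nat \<Rightarrow> 'w \<Rightarrow> 'a" and n :: nat
    and J :: "'j set" and \<Gamma> :: "'j \<Rightarrow> 't set"
    and \<rho> \<gamma> :: real
  assumes q: "prob_density \<mu> q"
    and n: "n \<ge> 1"
    and P: "prob_space P"
    and X_indep: "prob_space.indep_vars P (\<lambda>_. \<mu>) X {..<n}"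
    and X_density: "\<And>i. i < n \<Longrightarrow> distributed P \<mu> (X i) (\<lambda>x. ennreal (q x))"
    and prior: "prob_space \<pi>"
    and p: "\<And>\<theta>. \<theta> \<in> space \<pi> \<Longrightarrow> prob_density \<mu> (p \<theta>)"
    and p_measurable: "(\<lambda>(\<theta>, x). p \<theta> x) \<in> borel_measurable (\<pi> \<Otimes>\<^sub>M \<mu>)"
    and cover: "countable_cover \<pi> J \<Gamma>"
    and sup_measurable:
      "\<And>j. j \<in> J \<Longrightarrow> (\<lambda>x. SUP \<theta>\<in>\<Gamma> j. ennreal (p \<theta> x)) \<in> borel_measurable \<mu>"
    and \<rho>: "0 < \<rho>" "\<rho> < 1"
    and \<gamma>: "\<gamma> \<ge> 1"
  shows "eintegral P (\<lambda>\<omega>. eintegral \<pi> (\<lambda>\<theta>.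
             posterior \<pi> p n (\<lambda>i. X i \<omega>) \<theta> * renyi \<rho> \<mu> q (p \<theta>)))
         \<le> ereal \<gamma> * ln_ereal (eintegral \<pi> (\<lambda>\<theta>. exp_ereal (- (ereal (real n) * KL \<mu> q (p \<theta>)))))
               / ereal (\<rho> * (\<rho> - 1) * real n)
           + ereal ((\<gamma> - \<rho>) / (\<rho> * (1 - \<rho>) * real n))
               * ln_ereal (\<Sum>\<^sub>\<infinity>j\<in>J. ereal (rpow (measure \<pi> (\<Gamma> j)) ((\<gamma> - 1) / (\<gamma> - \<rho>)))
                                       * (1 + r_ub \<mu> p (\<Gamma> j)) ^ n)"
    (is "?L \<le> ereal \<gamma> * ln_ereal ?E / ereal ?d + ereal ?e * ln_ereal ?S")
proof -
  interpret iid_bayes P \<pi> \<mu> q p X n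
    by (intro iid_bayes.intro iid_bayes_axioms.intro q n P X_indep X_density prior p p_measurable)
  define V where "V = (\<integral>\<theta>. boltzmann \<theta> \<partial>\<pi>)"
  have E: "?E = ereal V"
    by (simp add: V_def eintegral_exp_KL)
  have V: "0 \<le> V" "V \<le> 1"
    using integral_boltzmann_le_1 by (auto simp: V_def intro!: integral_nonneg_AE boltzmann_bounds)
  have S: "0 < ?S"
    using cover by (rule cover_sum_pos)
  have signs: "?d < 0" "0 < ?e"
    using \<rho> \<gamma> n by (auto simp: mult_less_0_iff zero_less_mult_iff)
  show ?thesis
  proof (cases "V = 0 \<or> ?S = \<infinity>")
    case True
    then have "ereal \<gamma> * ln_ereal ?E / ereal ?d + ereal ?e * ln_ereal ?S = \<infinity>"
    proof
      assume "V = 0"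
      then have "ereal \<gamma> * ln_ereal ?E / ereal ?d = \<infinity>"
        using signs \<gamma> unfolding E ln_ereal_def by simp
      then show ?thesis by simp
    next
      assume "?S = \<infinity>"
      then have "ln_ereal ?S = \<infinity>"
        by (simp add: ln_ereal_def)
      then have "ereal ?e * ln_ereal ?S = \<infinity>"
        using signs(2) by (simp only: ereal_mult_eq_PInfty ereal_less refl simp_thms)
      then show ?thesis by simp
    qed
    then show ?thesis by (simp only: ereal_less_eq)
  next
    case False
    then obtain c where c: "?S = ereal c" "0 < c"
      using S by (cases ?S) auto
    have V0: "0 < V" using False V by simp
    have d: "?d = - (\<rho> * (1 - \<rho>) * real n)"
      by (simp add: algebra_simps)
    have "\<gamma> * ln V / ?d + ?e * ln c = ((\<gamma> - \<rho>) * ln c - \<gamma> * ln V) / (\<rho> * (1 - \<rho>) * real n)"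
      unfolding d divide_minus_right diff_divide_distrib[of "(\<gamma> - \<rho>) * ln c"] times_divide_eq_left
      by (simp only: add.commute[of "- _"] diff_conv_add_uminus)
    moreover have "ereal \<gamma> * ln_ereal ?E / ereal ?d = ereal (\<gamma> * ln V / ?d)"
    proof -
      have "ln_ereal ?E = ereal (ln V)"
        using V0 by (simp add: E ln_ereal_def)
      then show ?thesis
        using signs(1) by (simp only: times_ereal.simps ereal_divide less_imp_neq if_False)
    qed
    moreover have "ereal ?e * ln_ereal ?S = ereal (?e * ln c)"
      using c(2) by (simp add: c(1) ln_ereal_def)
    ultimately have "ereal (((\<gamma> - \<rho>) * ln c - \<gamma> * ln V) / (\<rho> * (1 - \<rho>) * real n))
        = ereal \<gamma> * ln_ereal ?E / ereal ?d + ereal ?e * ln_ereal ?S"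
      by (simp only: plus_ereal.simps)
    with expected_posterior_risk_le[OF cover sup_measurable \<rho> \<gamma> refl V_def V0 c]
    show ?thesis
      by (simp only:)
  qed
qed

end
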